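(* If $\sum_{x\in\mathbb{Z}^d}b^2(x)=B(0)<\infty$ and $\sum_{x\in\mathbb{Z}^d}\mu(x)<\infty$, then the Gaussian field $W(t,x)=\sum_{z\in\mathbb{Z}^d}b(x-z)\,w(t,z)$, $t\ge0$, $x\in\mathbb{Z}^d$, regarded as an element $W(t,\cdot)$ of $l^2(\mathbb{Z}^d,\mu)$, is (almost surely, up to modification) a continuous function of time $t$.
   Context: $\{w(t,z),\,t\ge0\}_{z\in\mathbb{Z}^d}$ are independent standard one-dimensional Brownian motions and $b:\mathbb{Z}^d\to\mathbb{R}$. $\mu(x)>0$ is a weight on $\mathbb{Z}^d$ and $l^2(\mathbb{Z}^d,\mu)=\{f:\ \|f\|_\mu^2=\sum_{x}|f(x)|^2\mu(x)<\infty\}$. *)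

theory Defs
  imports "HOL-Probability.Probability"
begin

text \<open>
  Time is a real number restricted to \<open>t \<ge> 0\<close>; values of processes at negative times are
  irrelevant throughout. The lattice of dimension \<open>CARD('d)\<close> is the type \<open>int ^ 'd\<close>.
\<close>

definition standard_brownian_motion :: "'a measure \<Rightarrow> (real \<Rightarrow> 'a \<Rightarrow> real) \<Rightarrow> bool" where
  "standard_brownian_motion M B \<longleftrightarrow>
     (\<forall>t\<ge>0. B t \<in> borel_measurable M) \<and>
     (AE \<omega> in M. B 0 \<omega> = 0) \<and>
     (\<forall>s t. 0 \<le> s \<longrightarrow> s < t \<longrightarrow>
        distributed M lborel (\<lambda>\<omega>. B t \<omega> - B s \<omega>) (normal_density 0 (sqrt (t - s)))) \<and>
     (\<forall>(n::nat) \<tau>. 0 \<le> \<tau> 0 \<longrightarrow> mono_on {..n} \<tau> \<longrightarrow>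
        prob_space.indep_vars M (\<lambda>_. borel) (\<lambda>i \<omega>. B (\<tau> (Suc i)) \<omega> - B (\<tau> i) \<omega>) {..<n}) \<and>
     (AE \<omega> in M. continuous_on {0..} (\<lambda>t. B t \<omega>))"

text \<open>Independence of whole processes: each one is a random element of \<open>\<real>\<^bsup>[0,\<infinity>)\<^esup>\<close>
  with the product sigma-algebra.\<close>

definition independent_brownian_motions ::
    "'a measure \<Rightarrow> (real \<Rightarrow> 'i \<Rightarrow> 'a \<Rightarrow> real) \<Rightarrow> bool" where
  "independent_brownian_motions M w \<longleftrightarrow>
     (\<forall>z. standard_brownian_motion M (\<lambda>t. w t z)) \<and>
     prob_space.indep_vars M (\<lambda>z. PiM {0..} (\<lambda>_. borel)) (\<lambda>z \<omega>. \<lambda>t\<in>{0..}. w t z \<omega>) UNIV"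

text \<open>
  Unconditional convergence of a series of random variables in mean square. The lattice series
  below need not converge absolutely for any fixed \<open>\<omega>\<close>, so a pointwise \<^const>\<open>infsum\<close> would be
  the wrong notion. The extended-valued integral is used so that a difference that
  is not square integrable is not counted as having norm zero.
\<close>

definition mean_square_has_sum ::
    "'a measure \<Rightarrow> ('i \<Rightarrow> 'a \<Rightarrow> real) \<Rightarrow> ('a \<Rightarrow> real) \<Rightarrow> bool" where
  "mean_square_has_sum M X S \<longleftrightarrow>
     S \<in> borel_measurable M \<and>
     ((\<lambda>F. \<integral>\<^sup>+\<omega>. ennreal ((S \<omega> - (\<Sum>i\<in>F. X i \<omega>))\<^sup>2) \<partial>M) \<longlongrightarrow> 0) (finite_subsets_at_top UNIV)"

text \<open>\<open>W(t,x) = \<Sum>\<^sub>z b(x - z) w(t,z)\<close>. This determines each \<open>W(t,x)\<close> up to a null set only,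
  so it is a predicate on \<open>W\<close>.\<close>

definition is_lattice_field ::
    "'a measure \<Rightarrow> (int ^ 'd \<Rightarrow> real) \<Rightarrow> (real \<Rightarrow> int ^ 'd \<Rightarrow> 'a \<Rightarrow> real) \<Rightarrow>
     (real \<Rightarrow> int ^ 'd \<Rightarrow> 'a \<Rightarrow> real) \<Rightarrow> bool" where
  "is_lattice_field M b w W \<longleftrightarrow>
     (\<forall>t\<ge>0. \<forall>x. mean_square_has_sum M (\<lambda>z \<omega>. b (x - z) * w t z \<omega>) (W t x))"

text \<open>Normal laws include the degenerate ones (for instance \<open>W(0,x) = 0\<close>).\<close>

definition gaussian_rv :: "'a measure \<Rightarrow> ('a \<Rightarrow> real) \<Rightarrow> bool" where
  "gaussian_rv M X \<longleftrightarrow>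
     X \<in> borel_measurable M \<and>
     ((\<exists>m. AE \<omega> in M. X \<omega> = m) \<or>
      (\<exists>m \<sigma>. \<sigma> > 0 \<and> distributed M lborel X (normal_density m \<sigma>)))"

definition gaussian_field :: "'a measure \<Rightarrow> 'i set \<Rightarrow> ('i \<Rightarrow> 'a \<Rightarrow> real) \<Rightarrow> bool" where
  "gaussian_field M I X \<longleftrightarrow>
     (\<forall>F c. finite F \<longrightarrow> F \<subseteq> I \<longrightarrow> gaussian_rv M (\<lambda>\<omega>. \<Sum>i\<in>F. c i * X i \<omega>))"

definition weighted_l2 :: "('x \<Rightarrow> real) \<Rightarrow> ('x \<Rightarrow> real) set" where
  "weighted_l2 \<mu> = {f. (\<lambda>x. \<bar>f x\<bar>\<^sup>2 * \<mu> x) summable_on UNIV}"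

definition weighted_l2_norm :: "('x \<Rightarrow> real) \<Rightarrow> ('x \<Rightarrow> real) \<Rightarrow> real" where
  "weighted_l2_norm \<mu> f = sqrt (\<Sum>\<^sub>\<infinity>x. \<bar>f x\<bar>\<^sup>2 * \<mu> x)"

definition weighted_l2_continuous :: "('x \<Rightarrow> real) \<Rightarrow> (real \<Rightarrow> 'x \<Rightarrow> real) \<Rightarrow> bool" where
  "weighted_l2_continuous \<mu> u \<longleftrightarrow>
     (\<forall>t\<ge>0. u t \<in> weighted_l2 \<mu>) \<and>
     (\<forall>s\<ge>0. ((\<lambda>t. weighted_l2_norm \<mu> (\<lambda>x. u t x - u s x)) \<longlongrightarrow> 0) (at s within {0..}))"

text \<open>Modification as a process with values in functions of \<open>x\<close>: for each time, the two
  functions of \<open>x\<close> agree almost surely.\<close>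

definition is_modification ::
    "'a measure \<Rightarrow> (real \<Rightarrow> 'x \<Rightarrow> 'a \<Rightarrow> real) \<Rightarrow> (real \<Rightarrow> 'x \<Rightarrow> 'a \<Rightarrow> real) \<Rightarrow> bool" where
  "is_modification M V W \<longleftrightarrow>
     (\<forall>t\<ge>0. (\<forall>x. V t x \<in> borel_measurable M) \<and> (AE \<omega> in M. \<forall>x. V t x \<omega> = W t x \<omega>))"

end

theory Submission
  imports Defs
begin

text \<open>
  For a fixed lattice point \<open>x\<close> the series \<open>\<Sum>\<^sub>z b(x - z) w(t,z)\<close> is a single weighted sum of independent
  Brownian motions, and its coefficients have the same sum of squares \<open>B(0)\<close> for every \<open>x\<close>. It is
  therefore enough to find, for each \<open>x\<close>, a version \<open>V(t,x)\<close> with continuous paths together with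
  random variables that bound \<open>V(t,x)\<^sup>2\<close> for all \<open>t\<close> in \<open>[0,T]\<close> and whose expectations are bounded
  uniformly in \<open>x\<close>. Since \<open>\<mu>\<close> is summable, these bounds multiplied by \<open>\<mu>(x)\<close> are almost surely summable
  over the lattice (\<open>AE_summable_of_expectation_bound\<close>), and continuity in each coordinate becomes
  continuity in \<open>l\<^sup>2(\<mu>)\<close> by dominated convergence (\<open>weighted_l2_continuousI\<close>).

  The pathwise bound comes from dyadic chaining instead of a martingale inequality. A finite
  sum \<open>X\<close> of Brownian motions with total squared weight \<open>v\<close> has Gaussian increments, so the fourth
  moment of \<open>X t - X s\<close> is \<open>3 (t - s)\<^sup>2 v\<^sup>2\<close>; summing the fourth powers of all dyadic increments with
  geometric weights gives a random variable whose fourth root bounds \<open>\<bar>X\<bar>\<close> on \<open>[0,T]\<close> up to a constant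
  (\<open>dyadic_functional_bound\<close>) and whose expectation is at most \<open>13 T\<^sup>2 v\<^sup>2\<close>
  (\<open>dyadic_functional_expectation\<close>). Splitting the infinite series into finite blocks whose squared
  weights decrease like \<open>8\<^sup>-\<^sup>j\<close>, the blocks are almost surely dominated on \<open>[0,T]\<close> by a geometric
  series, and their sum is the continuous version (\<open>brownian_series_continuous\<close>). Fatou's lemma shows
  that it is also the unconditional mean-square sum, and mean-square sums are unique almost surely;
  since the lattice is countable, \<open>V\<close> is a modification of every version of the field.

  Gaussianity follows from the independence of the increments in time and of the processes in
  \<open>z\<close>, because centred normal laws are stable under independent sums and under mean-square limits
  (\<open>gaussian_field_of_mean_square_sums\<close>).
\<close>

section \<open>Centred Gaussian random variables\<close>

text \<open>
  A centred normal law of variance \<open>v\<close>, encoded through its characteristic function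
  \<open>exp (- v u\<^sup>2 / 2)\<close>. The degenerate law \<open>v = 0\<close> is included, and closure under independent sums
  and under limits can be read off from the characteristic functions.
\<close>

definition centered_gaussian :: "'a measure \<Rightarrow> ('a \<Rightarrow> real) \<Rightarrow> real \<Rightarrow> bool" where
  "centered_gaussian M X v \<longleftrightarrow> X \<in> borel_measurable M \<and> 0 \<le> v \<and>
     (\<forall>u. char (distr M borel X) u = complex_of_real (exp (- v * u\<^sup>2 / 2)))"

lemma centered_gaussian_measurable: "centered_gaussian M X v \<Longrightarrow> X \<in> borel_measurable M"
  and centered_gaussian_nonneg: "centered_gaussian M X v \<Longrightarrow> 0 \<le> v"
  and centered_gaussian_char:
    "centered_gaussian M X v \<Longrightarrow> char (distr M borel X) u = complex_of_real (exp (- v * u\<^sup>2 / 2))"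
  by (simp_all add: centered_gaussian_def)

context prob_space
begin

lemma char_distr_scale:
  assumes [measurable]: "X \<in> borel_measurable M"
  shows "char (distr M borel (\<lambda>\<omega>. a * X \<omega>)) u = char (distr M borel X) (a * u)"
  unfolding char_def by (simp add: integral_distr mult_ac)

lemma char_distr_cong_AE:
  assumes [measurable]: "X \<in> borel_measurable M" "Y \<in> borel_measurable M"
    and "AE \<omega> in M. X \<omega> = Y \<omega>"
  shows "char (distr M borel X) u = char (distr M borel Y) u"
  unfolding char_def using assms(3)
  by (simp add: integral_distr) (intro integral_cong_AE, auto)

lemma centered_gaussian_scale:
  assumes "centered_gaussian M X v"
  shows "centered_gaussian M (\<lambda>\<omega>. a * X \<omega>) (a\<^sup>2 * v)"
  using assms unfolding centered_gaussian_def
  by (auto simp: char_distr_scale power_mult_distrib mult_ac)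

lemma centered_gaussian_cong_AE:
  assumes "centered_gaussian M X v" "Y \<in> borel_measurable M" "AE \<omega> in M. X \<omega> = Y \<omega>"
  shows "centered_gaussian M Y v"
  using assms char_distr_cong_AE[of X Y] unfolding centered_gaussian_def by simp

lemma centered_gaussian_zero: "centered_gaussian M (\<lambda>_. 0) 0"
  unfolding centered_gaussian_def char_def by (simp add: integral_distr prob_space del: distr_const)

lemma centered_gaussian_of_normal:
  assumes X: "distributed M lborel X (normal_density 0 \<sigma>)" and \<sigma>: "\<sigma> > 0"
  shows "centered_gaussian M X (\<sigma>\<^sup>2)"
proof -
  have [measurable]: "X \<in> borel_measurable M"
    using distributed_measurable[OF X] by simp
  have "distributed M lborel (\<lambda>x. (X x - 0) / \<sigma>) std_normal_density"
    using X normal_standard_normal_convert[OF \<sigma>, of X 0] by simp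
  then have "distr M lborel (\<lambda>x. X x / \<sigma>) = std_normal_distribution"
    by (simp add: distributed_def)
  then have "distr M borel (\<lambda>x. X x / \<sigma>) = std_normal_distribution"
    by (simp cong: distr_cong)
  then have "char (distr M borel (\<lambda>x. (1 / \<sigma>) * X x)) (\<sigma> * u) = complex_of_real (exp (- \<sigma>\<^sup>2 * u\<^sup>2 / 2))" for u
    using char_std_normal_distribution by (simp add: fun_eq_iff power_mult_distrib)
  then show ?thesis
    using \<sigma> by (subst (asm) char_distr_scale) (auto simp: centered_gaussian_def)
qed

lemma centered_gaussian_imp_normal:
  assumes X: "centered_gaussian M X v" and v: "v > 0"
  shows "distributed M lborel X (normal_density 0 (sqrt v))"
proof -
  have [measurable]: "X \<in> borel_measurable M" using X by (rule centered_gaussian_measurable)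
  have "char (distr M borel (\<lambda>\<omega>. (1 / sqrt v) * X \<omega>)) = char std_normal_distribution"
    using v by (subst fun_eq_iff, subst char_distr_scale)
      (auto simp: centered_gaussian_char[OF X] char_std_normal_distribution power_mult_distrib power_divide)
  then have "distr M borel (\<lambda>\<omega>. (1 / sqrt v) * X \<omega>) = std_normal_distribution"
    by (intro Levy_uniqueness real_dist_normal_dist real_distribution_distr) auto
  then have "distributed M lborel (\<lambda>\<omega>. (X \<omega> - 0) / sqrt v) std_normal_density"
    by (simp add: distributed_def cong: distr_cong)
  then show ?thesis
    using v by (subst normal_standard_normal_convert) auto
qed

lemma centered_gaussian_zero_AE:
  assumes X: "centered_gaussian M X 0"
  shows "AE \<omega> in M. X \<omega> = 0"
proof -
  have [measurable]: "X \<in> borel_measurable M" using X by (rule centered_gaussian_measurable)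
  have "char (distr M borel X) = char (distr M borel (\<lambda>_. 0))"
    using centered_gaussian_char[OF X] centered_gaussian_char[OF centered_gaussian_zero] by auto
  then have "distr M borel X = distr M borel (\<lambda>_. 0)"
    by (intro Levy_uniqueness real_distribution_distr) auto
  moreover have "AE x in distr M borel (\<lambda>_. 0). x = (0::real)"
    by (subst AE_distr_iff) auto
  ultimately have "AE x in distr M borel X. x = (0::real)" by (simp only:)
  then show ?thesis by (subst (asm) AE_distr_iff) auto
qed

lemma centered_gaussian_imp_gaussian_rv:
  assumes X: "centered_gaussian M X v"
  shows "gaussian_rv M X"
proof (cases "v = 0")
  case True
  then show ?thesis
    using X centered_gaussian_zero_AE centered_gaussian_measurable unfolding gaussian_rv_def by metis
next
  case False
  then have "v > 0" using centered_gaussian_nonneg[OF X] by simp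
  then show ?thesis
    using centered_gaussian_imp_normal[OF X] centered_gaussian_measurable[OF X]
    unfolding gaussian_rv_def by (meson real_sqrt_gt_zero)
qed

lemma centered_gaussian_moment:
  assumes X: "centered_gaussian M X v" and k: "k > 0"
  shows "(\<integral>\<^sup>+\<omega>. ennreal (X \<omega> ^ (2 * k)) \<partial>M) = ennreal (fact (2 * k) / (2 ^ k * fact k) * v ^ k)"
proof (cases "v = 0")
  case True
  then have "AE \<omega> in M. X \<omega> = 0" using X centered_gaussian_zero_AE by simp
  then have "(\<integral>\<^sup>+\<omega>. ennreal (X \<omega> ^ (2 * k)) \<partial>M) = (\<integral>\<^sup>+\<omega>. 0 \<partial>M)"
    using k by (intro nn_integral_cong_AE) auto
  then show ?thesis using True k by simp
next
  case False
  then have v: "v > 0" using centered_gaussian_nonneg[OF X] by simp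
  have D: "distributed M lborel X (normal_density 0 (sqrt v))"
    by (rule centered_gaussian_imp_normal[OF X v])
  have "(\<integral>\<^sup>+\<omega>. ennreal (X \<omega> ^ (2 * k)) \<partial>M) =
      (\<integral>\<^sup>+x. ennreal (normal_density 0 (sqrt v) x) * ennreal (x ^ (2 * k)) \<partial>lborel)"
    by (rule distributed_nn_integral[OF D, symmetric]) simp
  also have "\<dots> = (\<integral>\<^sup>+x. ennreal (normal_density 0 (sqrt v) x * (x - 0) ^ (2 * k)) \<partial>lborel)"
    by (intro nn_integral_cong) (simp add: ennreal_mult)
  also have "\<dots> = ennreal (fact (2 * k) / ((2 / (sqrt v)\<^sup>2) ^ k * fact k))"
    by (rule nn_integral_eq_integrable[THEN iffD2])
      (use normal_moment_even[of "sqrt v" 0 k] v in \<open>auto simp: has_bochner_integral_iff\<close>)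
  also have "fact (2 * k) / ((2 / (sqrt v)\<^sup>2) ^ k * fact k) = fact (2 * k) / (2 ^ k * fact k) * v ^ k"
    using v by (simp add: power_divide)
  finally show ?thesis .
qed

lemma centered_gaussian_second_moment:
  "centered_gaussian M X v \<Longrightarrow> (\<integral>\<^sup>+\<omega>. ennreal ((X \<omega>)\<^sup>2) \<partial>M) = ennreal v"
  using centered_gaussian_moment[of X v 1] by simp

lemma centered_gaussian_fourth_moment:
  "centered_gaussian M X v \<Longrightarrow> (\<integral>\<^sup>+\<omega>. ennreal (X \<omega> ^ 4) \<partial>M) = ennreal (3 * v\<^sup>2)"
  using centered_gaussian_moment[of X v 2] by (simp add: fact_numeral)

lemma centered_gaussian_sum_indep:
  assumes I: "indep_vars (\<lambda>_. borel) X I" "finite I"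
    and X: "\<And>i. i \<in> I \<Longrightarrow> centered_gaussian M (X i) (v i)"
  shows "centered_gaussian M (\<lambda>\<omega>. \<Sum>i\<in>I. X i \<omega>) (\<Sum>i\<in>I. v i)"
  unfolding centered_gaussian_def
proof (intro conjI allI)
  show "(\<lambda>\<omega>. \<Sum>i\<in>I. X i \<omega>) \<in> borel_measurable M"
    using X by (auto intro: borel_measurable_sum centered_gaussian_measurable)
  show "0 \<le> (\<Sum>i\<in>I. v i)" using X by (intro sum_nonneg) (auto intro: centered_gaussian_nonneg)
  fix u
  have "char (distr M borel (\<lambda>\<omega>. \<Sum>i\<in>I. X i \<omega>)) u = (\<Prod>i\<in>I. complex_of_real (exp (- v i * u\<^sup>2 / 2)))"
    by (subst char_distr_sum[OF I(1)]) (intro prod.cong refl centered_gaussian_char X)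
  also have "\<dots> = complex_of_real (exp (- (\<Sum>i\<in>I. v i) * u\<^sup>2 / 2))"
    using \<open>finite I\<close> by (simp flip: exp_sum of_real_prod add: sum_negf sum_distrib_right sum_divide_distrib)
  finally show "char (distr M borel (\<lambda>\<omega>. \<Sum>i\<in>I. X i \<omega>)) u = complex_of_real (exp (- (\<Sum>i\<in>I. v i) * u\<^sup>2 / 2))" .
qed

lemma expectation_abs_le_L2:
  assumes [measurable]: "X \<in> borel_measurable M"
  shows "(\<integral>\<^sup>+\<omega>. ennreal \<bar>X \<omega>\<bar> \<partial>M)\<^sup>2 \<le> (\<integral>\<^sup>+\<omega>. ennreal ((X \<omega>)\<^sup>2) \<partial>M)"
proof -
  have "(\<integral>\<^sup>+\<omega>. ennreal \<bar>X \<omega>\<bar> * 1 \<partial>M)\<^sup>2 \<le> (\<integral>\<^sup>+\<omega>. (ennreal \<bar>X \<omega>\<bar>)\<^sup>2 \<partial>M) * (\<integral>\<^sup>+\<omega>. 1\<^sup>2 \<partial>M)"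
    by (rule Cauchy_Schwarz_nn_integral) auto
  then show ?thesis by (simp add: emeasure_space_1 ennreal_power)
qed

lemma char_distr_tendsto_mean_square:
  assumes X[measurable]: "\<And>i. X i \<in> borel_measurable M" and [measurable]: "S \<in> borel_measurable M"
    and lim: "((\<lambda>i. \<integral>\<^sup>+\<omega>. ennreal ((S \<omega> - X i \<omega>)\<^sup>2) \<partial>M) \<longlongrightarrow> 0) F"
  shows "((\<lambda>i. char (distr M borel (X i)) u) \<longlongrightarrow> char (distr M borel S) u) F"
proof -
  define D where "D i = enn2real (\<integral>\<^sup>+\<omega>. ennreal ((S \<omega> - X i \<omega>)\<^sup>2) \<partial>M)" for i
  have fin: "\<forall>\<^sub>F i in F. (\<integral>\<^sup>+\<omega>. ennreal ((S \<omega> - X i \<omega>)\<^sup>2) \<partial>M) < \<infinity>"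
    using lim by (rule order_tendstoD) simp
  have "(D \<longlongrightarrow> 0) F"
    unfolding D_def using tendsto_enn2real[of _ 0 F] lim by simp
  then have D: "((\<lambda>i. \<bar>u\<bar> * sqrt (D i)) \<longlongrightarrow> 0) F"
    by (auto intro!: tendsto_eq_intros)
  have le: "norm (char (distr M borel (X i)) u - char (distr M borel S) u) \<le> \<bar>u\<bar> * sqrt (D i)"
    if fin: "(\<integral>\<^sup>+\<omega>. ennreal ((S \<omega> - X i \<omega>)\<^sup>2) \<partial>M) < \<infinity>" for i
  proof -
    have l1: "(\<integral>\<^sup>+\<omega>. ennreal \<bar>S \<omega> - X i \<omega>\<bar> \<partial>M)\<^sup>2 \<le> ennreal (D i)"
      using expectation_abs_le_L2[of "\<lambda>\<omega>. S \<omega> - X i \<omega>"] fin unfolding D_def by simp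
    have fin1: "(\<integral>\<^sup>+\<omega>. ennreal \<bar>S \<omega> - X i \<omega>\<bar> \<partial>M) < \<infinity>"
      using l1 by (auto simp: less_top[symmetric] top_unique power2_eq_square)
    then have int: "integrable M (\<lambda>\<omega>. S \<omega> - X i \<omega>)"
      by (intro integrableI_bounded) auto
    have "ennreal ((\<integral>\<omega>. \<bar>S \<omega> - X i \<omega>\<bar> \<partial>M)\<^sup>2) \<le> ennreal (D i)"
      using l1 int by (subst (asm) nn_integral_eq_integral) (auto simp: ennreal_power)
    then have "(\<integral>\<omega>. \<bar>S \<omega> - X i \<omega>\<bar> \<partial>M)\<^sup>2 \<le> D i"
      by (simp add: D_def)
    then have L: "(\<integral>\<omega>. \<bar>S \<omega> - X i \<omega>\<bar> \<partial>M) \<le> sqrt (D i)"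
      by (rule real_le_rsqrt)
    have intX: "integrable M (\<lambda>\<omega>. iexp (u * Y \<omega>))" if [measurable]: "Y \<in> borel_measurable M" for Y
      by (rule integrable_const_bound[where B=1]) auto
    have "char (distr M borel (X i)) u - char (distr M borel S) u = (CLINT \<omega>|M. iexp (u * X i \<omega>) - iexp (u * S \<omega>))"
      unfolding char_def using intX[of "X i"] intX[of S] by (simp add: integral_distr)
    also have "norm \<dots> \<le> (\<integral>\<omega>. norm (iexp (u * X i \<omega>) - iexp (u * S \<omega>)) \<partial>M)"
      by (rule integral_norm_bound)
    also have "\<dots> \<le> (\<integral>\<omega>. \<bar>u\<bar> * \<bar>S \<omega> - X i \<omega>\<bar> \<partial>M)"
    proof (rule integral_mono)
      show "integrable M (\<lambda>\<omega>. norm (iexp (u * X i \<omega>) - iexp (u * S \<omega>)))"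
        by (intro integrable_norm Bochner_Integration.integrable_diff intX) auto
      show "integrable M (\<lambda>\<omega>. \<bar>u\<bar> * \<bar>S \<omega> - X i \<omega>\<bar>)" using int by auto
      fix \<omega>
      have "iexp (u * X i \<omega>) - iexp (u * S \<omega>) = iexp (u * S \<omega>) * (iexp (u * (X i \<omega> - S \<omega>)) - 1)"
        by (simp add: algebra_simps flip: exp_add)
      then have "norm (iexp (u * X i \<omega>) - iexp (u * S \<omega>)) = norm (iexp (u * (X i \<omega> - S \<omega>)) - 1)"
        by (simp add: norm_mult)
      also have "\<dots> \<le> \<bar>u * (X i \<omega> - S \<omega>)\<bar>"
        using iexp_approx1[of "u * (X i \<omega> - S \<omega>)" 0] by simp
      finally show "norm (iexp (u * X i \<omega>) - iexp (u * S \<omega>)) \<le> \<bar>u\<bar> * \<bar>S \<omega> - X i \<omega>\<bar>"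
        by (simp add: abs_mult abs_minus_commute)
    qed
    also have "\<dots> \<le> \<bar>u\<bar> * sqrt (D i)" using L by (simp add: mult_left_mono)
    finally show ?thesis .
  qed
  have "((\<lambda>i. char (distr M borel (X i)) u - char (distr M borel S) u) \<longlongrightarrow> 0) F"
    by (rule Lim_null_comparison[OF _ D]) (use fin in eventually_elim, use le in simp)
  then show ?thesis by (rule LIM_zero_cancel)
qed

text \<open>
  The functions \<open>exp (- v\<^sub>i u\<^sup>2 / 2)\<close> converge to the characteristic function \<open>\<phi>\<close> of the limit, so
  \<open>\<phi>(u) = \<phi>(1)\<close> raised to the power \<open>u\<^sup>2\<close>. Continuity of \<open>\<phi>\<close> at \<open>0\<close> excludes \<open>\<phi>(1) = 0\<close>, that is,
  divergence of the variances, and the limit has variance \<open>- 2 ln \<phi>(1)\<close>.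
\<close>

lemma centered_gaussian_mean_square_limit:
  assumes X: "\<And>i. centered_gaussian M (X i) (v i)" and S[measurable]: "S \<in> borel_measurable M"
    and lim: "((\<lambda>i. \<integral>\<^sup>+\<omega>. ennreal ((S \<omega> - X i \<omega>)\<^sup>2) \<partial>M) \<longlongrightarrow> 0) F" and F: "F \<noteq> bot"
  shows "\<exists>v. centered_gaussian M S v"
proof -
  interpret D: real_distribution "distr M borel S" by (rule real_distribution_distr) simp
  let ?\<phi> = "char (distr M borel S)"
  have "((\<lambda>i. char (distr M borel (X i)) u) \<longlongrightarrow> ?\<phi> u) F" for u
    by (rule char_distr_tendsto_mean_square[OF _ S lim]) (rule centered_gaussian_measurable[OF X])
  then have lim: "((\<lambda>i. complex_of_real (exp (- v i * u\<^sup>2 / 2))) \<longlongrightarrow> ?\<phi> u) F" for u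
    using centered_gaussian_char[OF X] by simp
  then have rl: "((\<lambda>i. exp (- v i * u\<^sup>2 / 2)) \<longlongrightarrow> Re (?\<phi> u)) F" for u
    using tendsto_Re[OF lim[of u]] by simp
  have \<phi>: "?\<phi> u = complex_of_real (Re (?\<phi> u))" for u
    by (rule tendsto_unique[OF F lim]) (intro tendsto_of_real rl)
  have pw: "Re (?\<phi> u) = Re (?\<phi> 1) powr (u\<^sup>2)" if "Re (?\<phi> 1) \<noteq> 0 \<or> u \<noteq> 0" for u
  proof (cases "u = 0")
    case True
    then show ?thesis using that D.char_zero by auto
  next
    case False
    have "((\<lambda>i. exp (- v i * 1\<^sup>2 / 2) powr (u\<^sup>2)) \<longlongrightarrow> Re (?\<phi> 1) powr (u\<^sup>2)) F"
      using False by (intro tendsto_powr' rl tendsto_const) auto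
    moreover have "exp (- v i * 1\<^sup>2 / 2) powr (u\<^sup>2) = exp (- v i * u\<^sup>2 / 2)" for i
      by (simp add: powr_def)
    ultimately show ?thesis using tendsto_unique[OF F rl] by simp
  qed
  have ge0: "Re (?\<phi> 1) \<ge> 0"
    by (rule tendsto_lowerbound[OF rl _ F]) auto
  have le1: "Re (?\<phi> 1) \<le> 1"
    using D.cmod_char_le_1[of 1] complex_Re_le_cmod[of "?\<phi> 1"] by linarith
  have pos: "Re (?\<phi> 1) > 0"
  proof (rule ccontr)
    assume "\<not> ?thesis"
    then have 0: "Re (?\<phi> 1) = 0" using ge0 by simp
    have "(\<lambda>u. Re (?\<phi> u)) \<midarrow>0\<rightarrow> Re (?\<phi> 0)"
      using D.isCont_char[of 0] by (intro tendsto_Re) (simp add: isCont_def)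
    moreover have "(\<lambda>u. Re (?\<phi> u)) \<midarrow>0\<rightarrow> 0"
      by (rule tendsto_cong[THEN iffD2, OF _ tendsto_const]) (auto simp: eventually_at_filter pw 0)
    ultimately have "Re (?\<phi> 0) = 0" using LIM_unique by blast
    then show False using D.char_zero by simp
  qed
  have "?\<phi> u = complex_of_real (exp (- (- 2 * ln (Re (?\<phi> 1))) * u\<^sup>2 / 2))" for u
    using \<phi>[of u] pw[of u] pos by (simp add: powr_def mult_ac)
  moreover have "0 \<le> - 2 * ln (Re (?\<phi> 1))" using pos le1 by simp
  ultimately show ?thesis unfolding centered_gaussian_def using S by blast
qed

end

section \<open>Mean-square convergence\<close>

lemma mean_square_has_sum_unique:
  assumes X[measurable]: "\<And>i. X i \<in> borel_measurable M"
    and S: "mean_square_has_sum M X S" and S': "mean_square_has_sum M X S'"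
  shows "AE \<omega> in M. S \<omega> = S' \<omega>"
proof -
  have [measurable]: "S \<in> borel_measurable M" "S' \<in> borel_measurable M"
    using S S' by (auto simp: mean_square_has_sum_def)
  let ?d = "\<lambda>S F. \<integral>\<^sup>+\<omega>. ennreal ((S \<omega> - (\<Sum>i\<in>F. X i \<omega>))\<^sup>2) \<partial>M"
  have le: "(\<integral>\<^sup>+\<omega>. ennreal ((S \<omega> - S' \<omega>)\<^sup>2) \<partial>M) \<le> 2 * (?d S F + ?d S' F)" for F
  proof -
    have "(\<integral>\<^sup>+\<omega>. ennreal ((S \<omega> - S' \<omega>)\<^sup>2) \<partial>M) \<le>
        (\<integral>\<^sup>+\<omega>. 2 * (ennreal ((S \<omega> - (\<Sum>i\<in>F. X i \<omega>))\<^sup>2) + ennreal ((S' \<omega> - (\<Sum>i\<in>F. X i \<omega>))\<^sup>2)) \<partial>M)"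
    proof (rule nn_integral_mono)
      fix \<omega>
      define m where "m = (\<Sum>i\<in>F. X i \<omega>)"
      have "(S \<omega> - S' \<omega>)\<^sup>2 \<le> 2 * ((S \<omega> - m)\<^sup>2 + (S' \<omega> - m)\<^sup>2)"
        using zero_le_power2[of "S \<omega> - m + (S' \<omega> - m)"] by (simp add: power2_eq_square algebra_simps)
      then have "ennreal ((S \<omega> - S' \<omega>)\<^sup>2) \<le> ennreal (2 * ((S \<omega> - m)\<^sup>2 + (S' \<omega> - m)\<^sup>2))"
        by (rule ennreal_leI)
      then show "ennreal ((S \<omega> - S' \<omega>)\<^sup>2) \<le> 2 * (ennreal ((S \<omega> - (\<Sum>i\<in>F. X i \<omega>))\<^sup>2) + ennreal ((S' \<omega> - (\<Sum>i\<in>F. X i \<omega>))\<^sup>2))"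
        by (simp add: ennreal_mult m_def)
    qed
    also have "\<dots> = 2 * (?d S F + ?d S' F)" by (simp add: nn_integral_cmult nn_integral_add)
    finally show ?thesis .
  qed
  have "((\<lambda>F. 2 * (?d S F + ?d S' F)) \<longlongrightarrow> 2 * (0 + 0)) (finite_subsets_at_top UNIV)"
    using S S' unfolding mean_square_has_sum_def by (intro ennreal_tendsto_cmult tendsto_add) auto
  then have "(\<integral>\<^sup>+\<omega>. ennreal ((S \<omega> - S' \<omega>)\<^sup>2) \<partial>M) \<le> 2 * (0 + 0)"
    by (rule tendsto_lowerbound) (use le in auto)
  then have "AE \<omega> in M. ennreal ((S \<omega> - S' \<omega>)\<^sup>2) = 0"
    by (subst nn_integral_0_iff_AE[symmetric]) auto
  then show ?thesis by eventually_elim simp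
qed

lemma mean_square_tendsto_sum:
  fixes X :: "'j \<Rightarrow> 'i \<Rightarrow> 'a \<Rightarrow> real"
  assumes I: "finite I"
    and [measurable]: "\<And>i j. i \<in> I \<Longrightarrow> X j i \<in> borel_measurable M" "\<And>i. i \<in> I \<Longrightarrow> S i \<in> borel_measurable M"
    and lim: "\<And>i. i \<in> I \<Longrightarrow> ((\<lambda>j. \<integral>\<^sup>+\<omega>. ennreal ((S i \<omega> - X j i \<omega>)\<^sup>2) \<partial>M) \<longlongrightarrow> 0) F"
  shows "((\<lambda>j. \<integral>\<^sup>+\<omega>. ennreal (((\<Sum>i\<in>I. c i * S i \<omega>) - (\<Sum>i\<in>I. c i * X j i \<omega>))\<^sup>2) \<partial>M) \<longlongrightarrow> 0) F"
proof (rule tendsto_sandwich[OF _ _ tendsto_const])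
  let ?R = "\<lambda>j. \<Sum>i\<in>I. ennreal ((c i)\<^sup>2 * card I) * (\<integral>\<^sup>+\<omega>. ennreal ((S i \<omega> - X j i \<omega>)\<^sup>2) \<partial>M)"
  have "(?R \<longlongrightarrow> (\<Sum>i\<in>I. ennreal ((c i)\<^sup>2 * card I) * 0)) F"
    by (intro tendsto_sum ennreal_tendsto_cmult lim) auto
  then show "(?R \<longlongrightarrow> 0) F" by simp
  show "\<forall>\<^sub>F j in F. (\<integral>\<^sup>+\<omega>. ennreal (((\<Sum>i\<in>I. c i * S i \<omega>) - (\<Sum>i\<in>I. c i * X j i \<omega>))\<^sup>2) \<partial>M) \<le> ?R j"
  proof (intro always_eventually allI)
    fix j
    have "(\<integral>\<^sup>+\<omega>. ennreal (((\<Sum>i\<in>I. c i * S i \<omega>) - (\<Sum>i\<in>I. c i * X j i \<omega>))\<^sup>2) \<partial>M)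
      \<le> (\<integral>\<^sup>+\<omega>. (\<Sum>i\<in>I. ennreal ((c i)\<^sup>2 * card I) * ennreal ((S i \<omega> - X j i \<omega>)\<^sup>2)) \<partial>M)"
    proof (rule nn_integral_mono)
      fix \<omega>
      have "((\<Sum>i\<in>I. c i * S i \<omega>) - (\<Sum>i\<in>I. c i * X j i \<omega>))\<^sup>2 = (\<Sum>i\<in>I. c i * (S i \<omega> - X j i \<omega>))\<^sup>2"
        by (simp add: sum_subtractf right_diff_distrib)
      also have "\<dots> \<le> (\<Sum>i\<in>I. (c i * (S i \<omega> - X j i \<omega>))\<^sup>2) * card I"
        by (rule sum_squared_le_sum_of_squares)
      also have "\<dots> = (\<Sum>i\<in>I. (c i)\<^sup>2 * card I * (S i \<omega> - X j i \<omega>)\<^sup>2)"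
        by (simp add: sum_distrib_left power_mult_distrib mult_ac)
      finally have "ennreal (((\<Sum>i\<in>I. c i * S i \<omega>) - (\<Sum>i\<in>I. c i * X j i \<omega>))\<^sup>2)
          \<le> ennreal (\<Sum>i\<in>I. (c i)\<^sup>2 * card I * (S i \<omega> - X j i \<omega>)\<^sup>2)"
        by (rule ennreal_leI)
      then show "ennreal (((\<Sum>i\<in>I. c i * S i \<omega>) - (\<Sum>i\<in>I. c i * X j i \<omega>))\<^sup>2)
          \<le> (\<Sum>i\<in>I. ennreal ((c i)\<^sup>2 * card I) * ennreal ((S i \<omega> - X j i \<omega>)\<^sup>2))"
        by (subst ennreal_mult'[symmetric] sum_ennreal; simp)+
    qed
    also have "\<dots> = ?R j"
      by (subst nn_integral_sum) (auto simp: nn_integral_cmult)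
    finally show "(\<integral>\<^sup>+\<omega>. ennreal (((\<Sum>i\<in>I. c i * S i \<omega>) - (\<Sum>i\<in>I. c i * X j i \<omega>))\<^sup>2) \<partial>M) \<le> ?R j" .
  qed
qed simp

section \<open>Dyadic chaining\<close>

text \<open>
  The weighted sum of the fourth powers of all dyadic increments of \<open>f\<close> on \<open>[0,T]\<close>. For a Brownian
  path the \<open>2\<^sup>n\<close> increments of level \<open>n\<close> contribute an expectation of order \<open>2\<^sup>n \<cdot> (T / 2\<^sup>n)\<^sup>2\<close>, which is
  of order \<open>2\<^sup>-\<^sup>n\<close>. The weight \<open>(10/9)\<^sup>4\<^sup>n\<close> is admissible because \<open>(10/9)\<^sup>4 < 2\<close>.
\<close>

definition dyadic_functional :: "real \<Rightarrow> (real \<Rightarrow> real) \<Rightarrow> ennreal" where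
  "dyadic_functional T f =
     (\<Sum>n. \<Sum>k<2^n. ennreal ((10/9) ^ (4 * n) * (f (T * real (Suc k) / 2 ^ n) - f (T * real k / 2 ^ n)) ^ 4))"

text \<open>
  A dyadic point of level \<open>n\<close> is reached from \<open>0\<close> by using at most one increment of each level
  up to \<open>n\<close>.
\<close>

lemma dyadic_chaining:
  fixes f :: "real \<Rightarrow> real"
  assumes inc: "\<And>n k. k < 2 ^ n \<Longrightarrow> \<bar>f (T * real (Suc k) / 2 ^ n) - f (T * real k / 2 ^ n)\<bar> \<le> K * r ^ n"
    and f0: "f 0 = 0" and K: "K \<ge> 0" and r: "r \<ge> 0"
  shows "k \<le> 2 ^ n \<Longrightarrow> \<bar>f (T * real k / 2 ^ n)\<bar> \<le> K * (\<Sum>j\<le>n. r ^ j)"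
proof (induction n arbitrary: k)
  case 0
  then have "k = 0 \<or> k = 1" by auto
  then show ?case using f0 K inc[of 0 0] by auto
next
  case (Suc n)
  have le: "K * (\<Sum>j\<le>n. r ^ j) \<le> K * (\<Sum>j\<le>Suc n. r ^ j)"
    using K r by (intro mult_left_mono) auto
  obtain m where "k = 2 * m \<or> k = 2 * m + 1" by (metis oddE evenE)
  then show ?case
  proof
    assume k: "k = 2 * m"
    then have "T * real k / 2 ^ Suc n = T * real m / 2 ^ n" by simp
    then show ?thesis using Suc.IH[of m] Suc.prems k le by auto
  next
    assume k: "k = 2 * m + 1"
    have "T * real (2 * m) / 2 ^ Suc n = T * real m / 2 ^ n" by simp
    then have "\<bar>f (T * real k / 2 ^ Suc n) - f (T * real m / 2 ^ n)\<bar> \<le> K * r ^ Suc n"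
      using inc[of "2 * m" "Suc n"] Suc.prems k by simp
    moreover have "\<bar>f (T * real m / 2 ^ n)\<bar> \<le> K * (\<Sum>j\<le>n. r ^ j)"
      using Suc.IH[of m] Suc.prems k by simp
    ultimately show ?thesis by (simp add: distrib_left)
  qed
qed

lemma dyadic_floor_tendsto:
  assumes T: "T > 0" and t: "0 \<le> t" "t \<le> T"
  shows "\<exists>k. (\<forall>n. k n \<le> 2 ^ n) \<and> (\<lambda>n. T * real (k n) / 2 ^ n) \<longlonglongrightarrow> t"
proof (intro exI conjI allI)
  define k where "k n = nat \<lfloor>t / T * 2 ^ n\<rfloor>" for n :: nat
  have kr: "real (k n) = of_int \<lfloor>t / T * 2 ^ n\<rfloor>" for n
    unfolding k_def using T t by simp
  show "k n \<le> 2 ^ n" for n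
  proof -
    have "t / T * 2 ^ n \<le> 1 * 2 ^ n" using T t by (intro mult_right_mono) auto
    then have "real (k n) \<le> 2 ^ n" unfolding kr using of_int_floor_le[of "t / T * 2 ^ n"] by linarith
    then show ?thesis by (metis of_nat_le_iff of_nat_numeral of_nat_power)
  qed
  have lim: "(\<lambda>n. T * (1 / 2) ^ n) \<longlonglongrightarrow> 0"
    by (auto intro!: tendsto_eq_intros LIMSEQ_realpow_zero)
  show "(\<lambda>n. T * real (k n) / 2 ^ n) \<longlonglongrightarrow> t"
  proof (rule LIM_zero_cancel, rule Lim_null_comparison[OF _ lim], intro always_eventually allI)
    fix n
    have "\<bar>real (k n) - t / T * 2 ^ n\<bar> \<le> 1" unfolding kr by linarith
    then have "T / 2 ^ n * \<bar>real (k n) - t / T * 2 ^ n\<bar> \<le> T / 2 ^ n * 1"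
      using T by (intro mult_left_mono) auto
    also have "T / 2 ^ n * \<bar>real (k n) - t / T * 2 ^ n\<bar> = \<bar>T / 2 ^ n * (real (k n) - t / T * 2 ^ n)\<bar>"
      using T by (simp add: abs_mult)
    also have "T / 2 ^ n * (real (k n) - t / T * 2 ^ n) = T * real (k n) / 2 ^ n - t"
      using T by (simp add: field_simps)
    finally show "norm (T * real (k n) / 2 ^ n - t) \<le> T * (1 / 2) ^ n"
      by (simp add: power_one_over divide_simps)
  qed
qed

text \<open>
  A bound \<open>K\<^sup>4\<close> on the functional bounds each increment of level \<open>n\<close> by \<open>K (9/10)\<^sup>n\<close>; the
  geometric series \<open>\<Sum>\<^sub>n (9/10)\<^sup>n = 10\<close> gives the constant.
\<close>

lemma dyadic_functional_bound:
  fixes f :: "real \<Rightarrow> real"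
  assumes cont: "continuous_on {0..T} f" and f0: "f 0 = 0" and T: "T > 0" and K: "K \<ge> 0"
    and le: "dyadic_functional T f \<le> ennreal (K ^ 4)" and t: "0 \<le> t" "t \<le> T"
  shows "\<bar>f t\<bar> \<le> 10 * K"
proof -
  have inc: "\<bar>f (T * real (Suc k) / 2 ^ n) - f (T * real k / 2 ^ n)\<bar> \<le> K * (9/10) ^ n" if k: "k < 2 ^ n" for n k
  proof -
    let ?g = "\<lambda>n k. ennreal ((10/9) ^ (4 * n) * (f (T * real (Suc k) / 2 ^ n) - f (T * real k / 2 ^ n)) ^ 4)"
    let ?d = "f (T * real (Suc k) / 2 ^ n) - f (T * real k / 2 ^ n)"
    have "?g n k \<le> (\<Sum>k<2^n. ?g n k)"
      using k by (intro member_le_sum) auto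
    also have "\<dots> = (\<Sum>n\<in>{n}. \<Sum>k<2^n. ?g n k)" by simp
    also have "\<dots> \<le> (\<Sum>n. \<Sum>k<2^n. ?g n k)" by (rule sum_le_suminf) auto
    also have "\<dots> \<le> ennreal (K ^ 4)" using le by (simp add: dyadic_functional_def)
    finally have "(10/9) ^ (4 * n) * ?d ^ 4 \<le> K ^ 4" using K by simp
    then have "?d ^ 4 \<le> K ^ 4 * (9/10) ^ (4 * n)" by (simp add: field_simps power_divide)
    also have "\<dots> = (K * (9/10) ^ n) ^ 4" by (simp add: power_mult_distrib power_mult[symmetric] mult.commute)
    finally have "\<bar>?d\<bar> ^ 4 \<le> (K * (9/10) ^ n) ^ 4" by simp
    then show ?thesis by (rule power_le_imp_le_base[of _ 3, simplified]) (use K in simp)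
  qed
  have sum_le: "(\<Sum>j\<le>n. (9/10::real) ^ j) \<le> 10" for n
    using sum_le_suminf[of "\<lambda>j. (9/10::real) ^ j" "{..n}"] suminf_geometric[of "9/10::real"] by (simp add: summable_geometric)
  obtain k where k: "\<And>n. k n \<le> 2 ^ n" and lim: "(\<lambda>n. T * real (k n) / 2 ^ n) \<longlonglongrightarrow> t"
    using dyadic_floor_tendsto[OF T t] by auto
  have mem: "T * real (k n) / 2 ^ n \<in> {0..T}" for n
  proof -
    have "real (k n) \<le> 2 ^ n" using k[of n] by (metis of_nat_le_iff of_nat_numeral of_nat_power)
    then show ?thesis using T by (simp add: field_simps)
  qed
  have "(\<lambda>n. f (T * real (k n) / 2 ^ n)) \<longlonglongrightarrow> f t"
    using continuous_on_tendsto_compose[OF cont lim] t mem by auto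
  then have "(\<lambda>n. \<bar>f (T * real (k n) / 2 ^ n)\<bar>) \<longlonglongrightarrow> \<bar>f t\<bar>" by (rule tendsto_rabs)
  then show ?thesis
  proof (rule LIMSEQ_le_const2, intro exI allI impI)
    fix n
    have "\<bar>f (T * real (k n) / 2 ^ n)\<bar> \<le> K * (\<Sum>j\<le>n. (9/10) ^ j)"
      by (rule dyadic_chaining[OF inc f0 K _ k]) auto
    also have "\<dots> \<le> K * 10" using K sum_le by (intro mult_left_mono) auto
    finally show "\<bar>f (T * real (k n) / 2 ^ n)\<bar> \<le> 10 * K" by simp
  qed
qed

context prob_space
begin

lemma dyadic_functional_measurable:
  assumes "\<And>t. 0 \<le> t \<Longrightarrow> X t \<in> borel_measurable M" and T: "T > 0"
  shows "(\<lambda>\<omega>. dyadic_functional T (\<lambda>t. X t \<omega>)) \<in> borel_measurable M"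
proof -
  have [measurable]: "X (T * real k / 2 ^ n) \<in> borel_measurable M" for k n
    using T by (intro assms(1)) simp
  show ?thesis unfolding dyadic_functional_def by measurable
qed

text \<open>
  The substitute for a maximal inequality: by \<open>dyadic_functional_bound\<close>, the fourth moment of the
  supremum over \<open>[0,T]\<close> is at most a multiple of \<open>T\<^sup>2 v\<^sup>2\<close> when the paths are continuous and start
  at \<open>0\<close>. Only the laws of single increments enter, not their independence.
\<close>

lemma dyadic_functional_expectation:
  assumes X: "\<And>t. 0 \<le> t \<Longrightarrow> X t \<in> borel_measurable M" and T: "T > 0"
    and inc: "\<And>s t. 0 \<le> s \<Longrightarrow> s \<le> t \<Longrightarrow> centered_gaussian M (\<lambda>\<omega>. X t \<omega> - X s \<omega>) ((t - s) * v)"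
    and v: "v \<ge> 0"
  shows "(\<integral>\<^sup>+\<omega>. dyadic_functional T (\<lambda>t. X t \<omega>) \<partial>M) \<le> ennreal (13 * T\<^sup>2 * v\<^sup>2)"
proof -
  have [measurable]: "X (T * real k / 2 ^ n) \<in> borel_measurable M" for k n
    using T by (intro X) simp
  have moment: "(\<integral>\<^sup>+\<omega>. ennreal ((10/9) ^ (4 * n) * (X (T * real (Suc k) / 2 ^ n) \<omega> - X (T * real k / 2 ^ n) \<omega>) ^ 4) \<partial>M)
      = ennreal ((10/9) ^ (4 * n) * (3 * (T / 2 ^ n * v)\<^sup>2))" for n k
  proof -
    have "centered_gaussian M (\<lambda>\<omega>. X (T * real (Suc k) / 2 ^ n) \<omega> - X (T * real k / 2 ^ n) \<omega>)
        ((T * real (Suc k) / 2 ^ n - T * real k / 2 ^ n) * v)"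
      using T by (intro inc) (auto simp: divide_right_mono)
    also have "T * real (Suc k) / 2 ^ n - T * real k / 2 ^ n = T / 2 ^ n"
      by (simp add: field_simps)
    finally show ?thesis
      by (simp add: ennreal_mult nn_integral_cmult centered_gaussian_fourth_moment del: of_nat_Suc)
  qed
  have "(\<integral>\<^sup>+\<omega>. dyadic_functional T (\<lambda>t. X t \<omega>) \<partial>M)
     = (\<Sum>n. \<Sum>k<(2::nat)^n. ennreal ((10/9) ^ (4 * n) * (3 * (T / 2 ^ n * v)\<^sup>2)))"
    unfolding dyadic_functional_def
    by (subst nn_integral_suminf) (auto simp: nn_integral_sum moment simp del: of_nat_Suc sum_ennreal)
  also have "\<dots> = (\<Sum>n. ennreal (3 * T\<^sup>2 * v\<^sup>2 * (5000/6561) ^ n))"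
  proof (intro suminf_cong)
    fix n
    have "2 ^ n * ((10/9) ^ (4 * n) * (3 * (T / 2 ^ n * v)\<^sup>2)) = 3 * T\<^sup>2 * v\<^sup>2 * ((10/9) ^ (4 * n) / 2 ^ n)"
      by (simp add: power2_eq_square field_simps)
    also have "(10/9) ^ (4 * n) / 2 ^ n = (5000/6561 :: real) ^ n"
      by (simp add: power_mult power_divide[symmetric] power_numeral_reduce)
    finally have "2 ^ n * ((10/9) ^ (4 * n) * (3 * (T / 2 ^ n * v)\<^sup>2)) = 3 * T\<^sup>2 * v\<^sup>2 * (5000/6561) ^ n" .
    then show "(\<Sum>k<(2::nat)^n. ennreal ((10/9) ^ (4 * n) * (3 * (T / 2 ^ n * v)\<^sup>2))) = ennreal (3 * T\<^sup>2 * v\<^sup>2 * (5000/6561) ^ n)"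
      by (subst sum_ennreal) auto
  qed
  also have "\<dots> = ennreal (\<Sum>n. 3 * T\<^sup>2 * v\<^sup>2 * (5000/6561) ^ n)"
    by (rule suminf_ennreal2) (auto intro!: summable_mult summable_geometric)
  also have "(\<Sum>n. 3 * T\<^sup>2 * v\<^sup>2 * (5000/6561) ^ n) = 3 * T\<^sup>2 * v\<^sup>2 * (6561/1561)"
    by (subst suminf_mult) (auto intro!: summable_geometric simp: suminf_geometric)
  also have "ennreal (3 * T\<^sup>2 * v\<^sup>2 * (6561/1561)) \<le> ennreal (13 * T\<^sup>2 * v\<^sup>2)"
    by (intro ennreal_leI) simp
  finally show ?thesis .
qed

end

section \<open>Linear combinations of independent Brownian motions\<close>

text \<open>
  A countable family of independent standard Brownian motions on a probability space.
\<close>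

locale brownian_family = prob_space M for M :: "'a measure" +
  fixes w :: "real \<Rightarrow> 'i::countable \<Rightarrow> 'a \<Rightarrow> real"
  assumes brownian: "independent_brownian_motions M w"
begin

lemma brownian_each: "standard_brownian_motion M (\<lambda>t. w t z)"
  using brownian by (simp add: independent_brownian_motions_def)

lemma brownian_measurable: "0 \<le> t \<Longrightarrow> w t z \<in> borel_measurable M"
  using brownian_each[of z] by (simp add: standard_brownian_motion_def)

lemma brownian_paths: "AE \<omega> in M. \<forall>z. w 0 z \<omega> = 0 \<and> continuous_on {0..} (\<lambda>t. w t z \<omega>)"
  unfolding AE_all_countable using brownian_each by (auto simp: standard_brownian_motion_def)

lemma brownian_increment:
  assumes "0 \<le> s" "s \<le> t"
  shows "centered_gaussian M (\<lambda>\<omega>. w t z \<omega> - w s z \<omega>) (t - s)"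
proof (cases "s = t")
  case True
  then show ?thesis using centered_gaussian_zero by simp
next
  case False
  then have "distributed M lborel (\<lambda>\<omega>. w t z \<omega> - w s z \<omega>) (normal_density 0 (sqrt (t - s)))"
    using brownian_each[of z] assms by (simp add: standard_brownian_motion_def)
  from centered_gaussian_of_normal[OF this] show ?thesis using assms False by simp
qed

text \<open>
  Summation by parts turns the values at increasing times into the independent increments.
\<close>

lemma brownian_combination_mono:
  assumes mono: "mono_on {..n::nat} \<tau>" and \<tau>0: "\<tau> 0 = (0::real)"
  shows "\<exists>v. centered_gaussian M (\<lambda>\<omega>. \<Sum>i\<le>n. b i * w (\<tau> i) z \<omega>) v"
proof -
  define inc where "inc j \<omega> = w (\<tau> (Suc j)) z \<omega> - w (\<tau> j) z \<omega>" for j \<omega>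
  define B where "B j = (\<Sum>i=Suc j..n. b i)" for j
  have \<tau>_le: "\<tau> i \<le> \<tau> j" if "i \<le> j" "j \<le> n" for i j
    using mono_onD[OF mono, of i j] that by simp
  have \<tau>_nonneg: "0 \<le> \<tau> i" if "i \<le> n" for i
    using \<tau>_le[of 0 i] that \<tau>0 by simp
  have "indep_vars (\<lambda>_. borel) inc {..<n}"
    using brownian_each[of z] mono \<tau>0 unfolding standard_brownian_motion_def inc_def by simp
  then have "indep_vars (\<lambda>_. borel) (\<lambda>j \<omega>. B j * inc j \<omega>) {..<n}"
    by (rule indep_vars_compose2) auto
  moreover have "centered_gaussian M (\<lambda>\<omega>. B j * inc j \<omega>) ((B j)\<^sup>2 * (\<tau> (Suc j) - \<tau> j))" if "j \<in> {..<n}" for j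
    unfolding inc_def using that by (intro centered_gaussian_scale brownian_increment \<tau>_nonneg \<tau>_le) auto
  ultimately have g: "centered_gaussian M (\<lambda>\<omega>. \<Sum>j<n. B j * inc j \<omega>) (\<Sum>j<n. (B j)\<^sup>2 * (\<tau> (Suc j) - \<tau> j))"
    by (intro centered_gaussian_sum_indep) auto
  have "centered_gaussian M (\<lambda>\<omega>. \<Sum>i\<le>n. b i * w (\<tau> i) z \<omega>) (\<Sum>j<n. (B j)\<^sup>2 * (\<tau> (Suc j) - \<tau> j))"
  proof (rule centered_gaussian_cong_AE[OF g])
    show "(\<lambda>\<omega>. \<Sum>i\<le>n. b i * w (\<tau> i) z \<omega>) \<in> borel_measurable M"
      by (intro borel_measurable_sum borel_measurable_times borel_measurable_const brownian_measurable \<tau>_nonneg) auto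
    show "AE \<omega> in M. (\<Sum>j<n. B j * inc j \<omega>) = (\<Sum>i\<le>n. b i * w (\<tau> i) z \<omega>)"
      using brownian_paths
    proof eventually_elim
      fix \<omega> assume "\<forall>z. w 0 z \<omega> = 0 \<and> continuous_on {0..} (\<lambda>t. w t z \<omega>)"
      then have "w (\<tau> i) z \<omega> = (\<Sum>j<i. inc j \<omega>)" for i
        unfolding inc_def using sum_lessThan_telescope[of "\<lambda>i. w (\<tau> i) z \<omega>" i] \<tau>0 by simp
      then have "(\<Sum>i\<le>n. b i * w (\<tau> i) z \<omega>) = (\<Sum>i\<le>n. \<Sum>j<i. b i * inc j \<omega>)"
        by (simp add: sum_distrib_left)
      also have "\<dots> = (\<Sum>j<n. \<Sum>i=Suc j..n. b i * inc j \<omega>)" by (rule sum.nested_swap')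
      finally show "(\<Sum>j<n. B j * inc j \<omega>) = (\<Sum>i\<le>n. b i * w (\<tau> i) z \<omega>)"
        by (simp add: B_def sum_distrib_right)
    qed
  qed
  then show ?thesis by blast
qed

lemma brownian_combination_times:
  assumes T: "finite T" "T \<subseteq> {0..}"
  shows "\<exists>v. centered_gaussian M (\<lambda>\<omega>. \<Sum>t\<in>T. a t * w t z \<omega>) v"
proof -
  define l where "l = sorted_list_of_set T"
  define \<tau> where "\<tau> i = (case i of 0 \<Rightarrow> 0 | Suc j \<Rightarrow> l ! j)" for i
  define b where "b i = (case i of 0 \<Rightarrow> 0 | Suc j \<Rightarrow> a (l ! j))" for i
  have l: "sorted l" "distinct l" "set l = T" using T by (auto simp: l_def)
  have "mono_on {..length l} \<tau>"
  proof (rule mono_onI)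
    fix i j assume "i \<in> {..length l}" "j \<in> {..length l}" "i \<le> j"
    then show "\<tau> i \<le> \<tau> j"
      using l T nth_mem[of "j - 1" l] by (auto simp: \<tau>_def split: nat.split intro!: sorted_nth_mono)
  qed
  from brownian_combination_mono[OF this, of b z]
  obtain v where v: "centered_gaussian M (\<lambda>\<omega>. \<Sum>i\<le>length l. b i * w (\<tau> i) z \<omega>) v"
    by (auto simp: \<tau>_def)
  have "(\<Sum>i\<le>length l. b i * w (\<tau> i) z \<omega>) = (\<Sum>t\<in>T. a t * w t z \<omega>)" for \<omega>
  proof -
    have "(\<Sum>i\<le>length l. b i * w (\<tau> i) z \<omega>) = (\<Sum>i<length l. a (l ! i) * w (l ! i) z \<omega>)"
      by (subst lessThan_Suc_atMost[symmetric], subst sum.lessThan_Suc_shift) (simp add: b_def \<tau>_def)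
    also have "\<dots> = (\<Sum>t\<in>T. a t * w t z \<omega>)"
      by (rule sum.reindex_bij_betw) (rule bij_betw_nth, use l in auto)
    finally show ?thesis .
  qed
  then show ?thesis using v by auto
qed

lemma brownian_indep_combinations:
  assumes T: "finite T" "T \<subseteq> {0..}"
  shows "indep_vars (\<lambda>_. borel) (\<lambda>z \<omega>. \<Sum>t\<in>T. a t z * w t z \<omega>) Z"
proof -
  have "indep_vars (\<lambda>z. PiM {0..} (\<lambda>_. borel)) (\<lambda>z \<omega>. \<lambda>t\<in>{0..}. w t z \<omega>) Z"
    using brownian by (auto simp: independent_brownian_motions_def intro: indep_vars_subset)
  then have "indep_vars (\<lambda>_. borel) (\<lambda>z \<omega>. \<Sum>t\<in>T. a t z * (\<lambda>t\<in>{0..}. w t z \<omega>) t) Z"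
    by (rule indep_vars_compose2)
      (use T in \<open>auto intro!: borel_measurable_sum borel_measurable_times measurable_component_singleton\<close>)
  also have "(\<lambda>z \<omega>. \<Sum>t\<in>T. a t z * (\<lambda>t\<in>{0..}. w t z \<omega>) t) = (\<lambda>z \<omega>. \<Sum>t\<in>T. a t z * w t z \<omega>)"
    using T by (intro ext sum.cong) auto
  finally show ?thesis .
qed

lemma brownian_combination:
  assumes T: "finite T" "T \<subseteq> {0..}" and Z: "finite Z"
  shows "\<exists>v. centered_gaussian M (\<lambda>\<omega>. \<Sum>z\<in>Z. \<Sum>t\<in>T. a t z * w t z \<omega>) v"
proof -
  have "\<forall>z. \<exists>v. centered_gaussian M (\<lambda>\<omega>. \<Sum>t\<in>T. a t z * w t z \<omega>) v"
    by (intro allI brownian_combination_times[OF T])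
  then obtain v where "\<And>z. centered_gaussian M (\<lambda>\<omega>. \<Sum>t\<in>T. a t z * w t z \<omega>) (v z)"
    by metis
  then show ?thesis
    using centered_gaussian_sum_indep[OF brownian_indep_combinations[OF T] Z] by blast
qed

lemma brownian_sum_increment:
  assumes st: "0 \<le> s" "s \<le> t" and Z: "finite Z"
  shows "centered_gaussian M (\<lambda>\<omega>. \<Sum>z\<in>Z. c z * (w t z \<omega> - w s z \<omega>)) ((t - s) * (\<Sum>z\<in>Z. (c z)\<^sup>2))"
proof (cases "s = t")
  case True
  then show ?thesis using centered_gaussian_zero by simp
next
  case False
  define a where "a r z = (if r = t then c z else - c z)" for r z
  have eq: "(\<Sum>r\<in>{s, t}. a r z * w r z \<omega>) = c z * (w t z \<omega> - w s z \<omega>)" for z \<omega>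
    using False by (simp add: a_def algebra_simps)
  have "indep_vars (\<lambda>_. borel) (\<lambda>z \<omega>. c z * (w t z \<omega> - w s z \<omega>)) Z"
    using brownian_indep_combinations[of "{s, t}" a Z] st unfolding eq by auto
  then have "centered_gaussian M (\<lambda>\<omega>. \<Sum>z\<in>Z. c z * (w t z \<omega> - w s z \<omega>)) (\<Sum>z\<in>Z. (c z)\<^sup>2 * (t - s))"
    using Z st by (intro centered_gaussian_sum_indep centered_gaussian_scale brownian_increment) auto
  then show ?thesis by (simp add: sum_distrib_left mult.commute)
qed

lemma brownian_sum_second_moment:
  assumes t: "0 \<le> t" and Z: "finite Z"
  shows "(\<integral>\<^sup>+\<omega>. ennreal ((\<Sum>z\<in>Z. c z * w t z \<omega>)\<^sup>2) \<partial>M) = ennreal (t * (\<Sum>z\<in>Z. (c z)\<^sup>2))"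
proof -
  have "(\<integral>\<^sup>+\<omega>. ennreal ((\<Sum>z\<in>Z. c z * w t z \<omega>)\<^sup>2) \<partial>M)
      = (\<integral>\<^sup>+\<omega>. ennreal ((\<Sum>z\<in>Z. c z * (w t z \<omega> - w 0 z \<omega>))\<^sup>2) \<partial>M)"
    using brownian_paths by (intro nn_integral_cong_AE) (auto elim!: eventually_mono)
  then show ?thesis
    using centered_gaussian_second_moment[OF brownian_sum_increment[of 0 t Z c]] t Z by simp
qed

end

context brownian_family
begin

text \<open>
  A finite linear combination of values of the field is the mean-square limit of finite linear
  combinations of values of the Brownian motions.
\<close>

lemma gaussian_field_of_mean_square_sums:
  fixes W :: "real \<Rightarrow> 'x \<Rightarrow> 'a \<Rightarrow> real"
  assumes W: "\<And>t x. 0 \<le> t \<Longrightarrow> mean_square_has_sum M (\<lambda>z \<omega>. c x z * w t z \<omega>) (W t x)"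
  shows "gaussian_field M ({0..} \<times> UNIV) (\<lambda>(t, x). W t x)"
  unfolding gaussian_field_def
proof (intro allI impI)
  fix I :: "(real \<times> 'x) set" and d assume I: "finite I" "I \<subseteq> {0..} \<times> UNIV"
  define T where "T = fst ` I"
  have T: "finite T" "T \<subseteq> {0..}" using I by (auto simp: T_def)
  define a where "a t z = (\<Sum>i\<in>{i \<in> I. fst i = t}. d i * c (snd i) z)" for t z
  let ?S = "\<lambda>\<omega>. \<Sum>i\<in>I. d i * (case i of (t, x) \<Rightarrow> W t x) \<omega>"
  let ?P = "\<lambda>Z i \<omega>. \<Sum>z\<in>Z. c (snd i) z * w (fst i) z \<omega>"
  have meas[measurable]: "(case i of (t, x) \<Rightarrow> W t x) \<in> borel_measurable M" if "i \<in> I" for i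
    using that I W by (auto simp: mean_square_has_sum_def split: prod.split)
  have measP[measurable]: "?P Z i \<in> borel_measurable M" if "i \<in> I" for Z i
    using that I by (intro borel_measurable_sum borel_measurable_times borel_measurable_const brownian_measurable) auto
  have regroup: "(\<Sum>i\<in>I. d i * ?P Z i \<omega>) = (\<Sum>z\<in>Z. \<Sum>t\<in>T. a t z * w t z \<omega>)" for Z \<omega>
  proof -
    have "(\<Sum>t\<in>T. a t z * w t z \<omega>) = (\<Sum>i\<in>I. d i * (c (snd i) z * w (fst i) z \<omega>))" for z
    proof -
      have "(\<Sum>t\<in>T. a t z * w t z \<omega>) = (\<Sum>t\<in>T. \<Sum>i\<in>{i \<in> I. fst i = t}. d i * (c (snd i) z * w (fst i) z \<omega>))"
        unfolding a_def sum_distrib_right by (intro sum.cong) auto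
      also have "\<dots> = (\<Sum>i\<in>I. d i * (c (snd i) z * w (fst i) z \<omega>))"
        by (rule sum.group) (use I T in \<open>auto simp: T_def\<close>)
      finally show ?thesis .
    qed
    then show ?thesis by (simp only: sum_distrib_left sum.swap[of _ Z I])
  qed
  have "\<forall>Z. \<exists>v. centered_gaussian M (\<lambda>\<omega>. \<Sum>i\<in>I. d i * ?P Z i \<omega>) v"
  proof
    fix Z
    show "\<exists>v. centered_gaussian M (\<lambda>\<omega>. \<Sum>i\<in>I. d i * ?P Z i \<omega>) v"
    proof (cases "finite Z")
      case True
      then show ?thesis unfolding regroup by (rule brownian_combination[OF T])
    next
      \<comment> \<open>A sum over an infinite set is \<open>0\<close> by convention.\<close>
      case False
      then show ?thesis using centered_gaussian_zero by auto
    qed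
  qed
  from choice[OF this]
  obtain v where v: "centered_gaussian M (\<lambda>\<omega>. \<Sum>i\<in>I. d i * ?P Z i \<omega>) (v Z)" for Z by blast
  have "\<exists>v. centered_gaussian M ?S v"
  proof (rule centered_gaussian_mean_square_limit[OF v])
    show "((\<lambda>Z. \<integral>\<^sup>+\<omega>. ennreal ((?S \<omega> - (\<Sum>i\<in>I. d i * ?P Z i \<omega>))\<^sup>2) \<partial>M) \<longlongrightarrow> 0) (finite_subsets_at_top UNIV)"
    proof (rule mean_square_tendsto_sum[OF I(1) measP meas])
      fix i assume "i \<in> I"
      then show "((\<lambda>Z. \<integral>\<^sup>+\<omega>. ennreal (((case i of (t, x) \<Rightarrow> W t x) \<omega> - ?P Z i \<omega>)\<^sup>2) \<partial>M) \<longlongrightarrow> 0) (finite_subsets_at_top UNIV)"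
        using W[of "fst i" "snd i"] I by (auto simp: mean_square_has_sum_def split: prod.split)
    qed
  qed (auto intro!: borel_measurable_sum borel_measurable_times meas)
  then show "gaussian_rv M ?S" using centered_gaussian_imp_gaussian_rv by blast
qed

end

section \<open>Continuous versions of series of Brownian motions\<close>

text \<open>
  Finite sets along which the partial sums of \<open>\<Sum>\<^sub>z (c z)\<^sup>2\<close> converge at the rate \<open>8\<^sup>-\<^sup>j\<close>. The factor
  \<open>B + 1\<close> instead of \<open>B\<close> keeps the tolerance positive when all coefficients vanish.
\<close>

lemma square_summable_exhaustion:
  fixes c :: "'i \<Rightarrow> real"
  assumes c: "((\<lambda>z. (c z)\<^sup>2) has_sum B) UNIV"
  obtains A :: "nat \<Rightarrow> 'i set" where "A 0 = {}" "\<And>j. finite (A j)" "\<And>j k. j \<le> k \<Longrightarrow> A j \<subseteq> A k"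
    "\<And>j D. finite D \<Longrightarrow> D \<inter> A j = {} \<Longrightarrow> (\<Sum>z\<in>D. (c z)\<^sup>2) \<le> (B + 1) / 8 ^ j"
proof -
  have le_B: "(\<Sum>z\<in>D. (c z)\<^sup>2) \<le> B" if "finite D" for D
    using finite_sum_le_has_sum[OF c that] by simp
  have "\<exists>F. finite F \<and> (\<forall>D. finite D \<longrightarrow> D \<inter> F = {} \<longrightarrow> (\<Sum>z\<in>D. (c z)\<^sup>2) \<le> (B + 1) / 8 ^ j)" for j :: nat
  proof -
    have "(B + 1) / 8 ^ j > 0" using le_B[of "{}"] by simp
    then have "\<forall>\<^sub>F F in finite_subsets_at_top UNIV. B - (B + 1) / 8 ^ j < (\<Sum>z\<in>F. (c z)\<^sup>2)"
      using c unfolding has_sum_def by (intro order_tendstoD) auto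
    then obtain F where F: "finite F" "B - (B + 1) / 8 ^ j < (\<Sum>z\<in>F. (c z)\<^sup>2)"
      unfolding eventually_finite_subsets_at_top by auto
    have "(\<Sum>z\<in>D. (c z)\<^sup>2) \<le> (B + 1) / 8 ^ j" if "finite D" "D \<inter> F = {}" for D
      using le_B[of "D \<union> F"] sum.union_disjoint[of D F "\<lambda>z. (c z)\<^sup>2"] F that by simp
    then show ?thesis using F by blast
  qed
  then obtain F where F: "\<And>j. finite (F j)"
    "\<And>j D. finite D \<Longrightarrow> D \<inter> F j = {} \<Longrightarrow> (\<Sum>z\<in>D. (c z)\<^sup>2) \<le> (B + 1) / 8 ^ j"
    by metis
  define A where "A j = (\<Union>i\<in>{1..j}. F i)" for j :: nat
  show ?thesis
  proof (rule that[of A])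
    fix j D assume D: "finite D" "D \<inter> A j = {}"
    show "(\<Sum>z\<in>D. (c z)\<^sup>2) \<le> (B + 1) / 8 ^ j"
    proof (cases "j = 0")
      case True
      then show ?thesis using le_B[OF D(1)] by simp
    next
      case False
      then have "F j \<subseteq> A j" unfolding A_def by (intro UN_upper) auto
      then have "D \<inter> F j = {}" using D by blast
      then show ?thesis using F D by blast
    qed
  next
    show "A j \<subseteq> A k" if "j \<le> k" for j k
      unfolding A_def using that by (intro UN_mono) auto
  qed (use F(1) in \<open>simp_all add: A_def\<close>)
qed

text \<open>
  If \<open>h\<close> is the weighted sum of the functionals of the blocks \<open>X j\<close>, then block \<open>j\<close> is at most
  \<open>10 h\<^sup>1\<^sup>/\<^sup>4 2\<^sup>-\<^sup>j\<close> on \<open>[0,T]\<close>, so the series converges uniformly and is bounded by \<open>20 h\<^sup>1\<^sup>/\<^sup>4\<close>. The square is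
  then at most \<open>400 (1 + h)\<close>, a bound linear in \<open>h\<close>.
\<close>

lemma block_series:
  fixes X :: "nat \<Rightarrow> real \<Rightarrow> real"
  assumes cont: "\<And>j. continuous_on {0..T} (X j)" and X0: "\<And>j. X j 0 = 0" and T: "T > 0"
    and fin: "(\<Sum>j. ennreal (16 ^ j) * dyadic_functional T (X j)) < \<infinity>"
  defines "h \<equiv> enn2real (\<Sum>j. ennreal (16 ^ j) * dyadic_functional T (X j))"
  shows "continuous_on {0..T} (\<lambda>t. \<Sum>j. X j t)"
    and "t \<in> {0..T} \<Longrightarrow> summable (\<lambda>j. X j t)"
    and "t \<in> {0..T} \<Longrightarrow> (\<Sum>j. X j t)\<^sup>2 \<le> 400 * (1 + h)"
proof -
  define K where "K = root 4 h"
  have h: "h \<ge> 0" by (simp add: h_def)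
  have K: "K \<ge> 0" "K ^ 4 = h" using h by (simp_all add: K_def)
  have hh: "(\<Sum>j. ennreal (16 ^ j) * dyadic_functional T (X j)) = ennreal h"
    using fin by (simp add: h_def)
  have bound: "\<bar>X j t\<bar> \<le> 10 * K * (1 / 2) ^ j" if t: "t \<in> {0..T}" for j t
  proof -
    have "ennreal (16 ^ j) * dyadic_functional T (X j) = (\<Sum>j\<in>{j}. ennreal (16 ^ j) * dyadic_functional T (X j))"
      by simp
    also have "\<dots> \<le> ennreal h" unfolding hh[symmetric] by (rule sum_le_suminf) auto
    finally have "ennreal (1 / 16 ^ j) * (ennreal (16 ^ j) * dyadic_functional T (X j)) \<le> ennreal (1 / 16 ^ j) * ennreal h"
      by (rule mult_left_mono) simp
    also have "ennreal (1 / 16 ^ j) * (ennreal (16 ^ j) * dyadic_functional T (X j)) = dyadic_functional T (X j)"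
      by (simp add: mult.assoc[symmetric] ennreal_mult[symmetric])
    also have "ennreal (1 / 16 ^ j) * ennreal h = ennreal (1 / 16 ^ j * h)"
      using h by (simp add: ennreal_mult[symmetric])
    also have "1 / 16 ^ j * h = (K * (1 / 2) ^ j) ^ 4"
    proof -
      have "((1 / 2 :: real) ^ j) ^ 4 = ((1 / 2) ^ 4) ^ j" by (simp only: power_mult[symmetric] mult.commute)
      then show ?thesis using K(2) by (simp add: power_mult_distrib power_divide)
    qed
    finally have "\<bar>X j t\<bar> \<le> 10 * (K * (1 / 2) ^ j)"
      by (intro dyadic_functional_bound[OF cont X0 T]) (use K t in auto)
    then show ?thesis by simp
  qed
  have sm: "summable (\<lambda>j. 10 * K * (1 / 2) ^ j)"
    by (intro summable_mult summable_geometric) simp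
  have "uniform_limit {0..T} (\<lambda>n t. \<Sum>j<n. X j t) (\<lambda>t. \<Sum>j. X j t) sequentially"
    by (rule Weierstrass_m_test[OF _ sm]) (use bound in simp)
  then show "continuous_on {0..T} (\<lambda>t. \<Sum>j. X j t)"
    by (rule uniform_limit_theorem[rotated]) (auto intro!: always_eventually continuous_on_sum cont)
  fix t assume t: "t \<in> {0..T}"
  show "summable (\<lambda>j. X j t)"
    by (rule summable_comparison_test'[OF sm, of 0]) (use bound[OF t] in simp)
  have "\<bar>\<Sum>j. X j t\<bar> \<le> (\<Sum>j. 10 * K * (1 / 2) ^ j)"
    by (rule norm_suminf_le[OF _ sm, where f="\<lambda>j. X j t", unfolded real_norm_def]) (rule bound[OF t])
  also have "\<dots> = 20 * K" by (subst suminf_mult) (auto simp: suminf_geometric)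
  finally have "(\<Sum>j. X j t)\<^sup>2 \<le> (20 * K)\<^sup>2" using abs_le_square_iff[of "\<Sum>j. X j t" "20 * K"] K by simp
  also have "(20 * K)\<^sup>2 \<le> 400 * (1 + K ^ 4)"
  proof -
    have "2 * K\<^sup>2 \<le> 1 + K ^ 4"
      using zero_le_power2[of "K\<^sup>2 - 1"] by (simp add: power2_diff flip: power_mult)
    then have "K\<^sup>2 \<le> 1 + K ^ 4" using zero_le_power2[of K] by linarith
    then show ?thesis by (simp add: power_mult_distrib)
  qed
  finally show "(\<Sum>j. X j t)\<^sup>2 \<le> 400 * (1 + h)" using K by simp
qed

context brownian_family
begin

text \<open>
  The partial sums over \<open>A\<close> and \<open>F\<close> differ only on the symmetric difference of the two sets, which
  is disjoint from the common subset \<open>N\<close>.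
\<close>

lemma brownian_partial_sums_distance:
  assumes t: "0 \<le> t" and fin: "finite A" "finite F" and N: "N \<subseteq> A" "N \<subseteq> F"
    and tail: "\<And>D. finite D \<Longrightarrow> D \<inter> N = {} \<Longrightarrow> (\<Sum>z\<in>D. (c z)\<^sup>2) \<le> \<delta>"
  shows "(\<integral>\<^sup>+\<omega>. ennreal (((\<Sum>z\<in>A. c z * w t z \<omega>) - (\<Sum>z\<in>F. c z * w t z \<omega>))\<^sup>2) \<partial>M) \<le> ennreal (t * \<delta>)"
proof -
  define e where "e z = (of_bool (z \<in> A) - of_bool (z \<in> F)) * c z" for z
  have "(\<Sum>z\<in>A. c z * w t z \<omega>) - (\<Sum>z\<in>F. c z * w t z \<omega>) = (\<Sum>z\<in>A \<union> F. e z * w t z \<omega>)" for \<omega>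
  proof -
    have "(\<Sum>z\<in>A. c z * w t z \<omega>) = (\<Sum>z\<in>A \<union> F. of_bool (z \<in> A) * c z * w t z \<omega>)"
      "(\<Sum>z\<in>F. c z * w t z \<omega>) = (\<Sum>z\<in>A \<union> F. of_bool (z \<in> F) * c z * w t z \<omega>)"
      using fin by (auto intro!: sum.mono_neutral_cong_left)
    then show ?thesis by (simp add: e_def left_diff_distrib sum_subtractf)
  qed
  then have "(\<integral>\<^sup>+\<omega>. ennreal (((\<Sum>z\<in>A. c z * w t z \<omega>) - (\<Sum>z\<in>F. c z * w t z \<omega>))\<^sup>2) \<partial>M)
      = ennreal (t * (\<Sum>z\<in>A \<union> F. (e z)\<^sup>2))"
    using brownian_sum_second_moment[of t "A \<union> F" e] t fin by simp
  also have "(\<Sum>z\<in>A \<union> F. (e z)\<^sup>2) = (\<Sum>z\<in>A \<union> F - N. (e z)\<^sup>2)"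
    using fin N by (intro sum.mono_neutral_right) (auto simp: e_def)
  also have "\<dots> \<le> (\<Sum>z\<in>A \<union> F - N. (c z)\<^sup>2)"
    by (intro sum_mono) (auto simp: e_def)
  also have "\<dots> \<le> \<delta>" using fin by (intro tail) auto
  finally show ?thesis using t by (simp add: ennreal_leI mult_left_mono)
qed

text \<open>
  The scalar case. The random variable \<open>H n\<close> controls the path on \<open>[0, n + 1]\<close>, and the bound on its
  expectation depends on the coefficients through \<open>B\<close> only; this uniformity is what allows
  summation over the lattice.
\<close>

lemma brownian_series_continuous:
  assumes c: "((\<lambda>z. (c z)\<^sup>2) has_sum B) UNIV"
  shows "\<exists>V H. (\<forall>t\<ge>0. mean_square_has_sum M (\<lambda>z \<omega>. c z * w t z \<omega>) (V t)) \<and>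
    (\<forall>n. H n \<in> borel_measurable M \<and> (\<integral>\<^sup>+\<omega>. H n \<omega> \<partial>M) \<le> ennreal (18 * (real (Suc n))\<^sup>2 * (B + 1)\<^sup>2)) \<and>
    (AE \<omega> in M. continuous_on {0..} (\<lambda>t. V t \<omega>) \<and>
       (\<forall>n. \<forall>t\<in>{0..real (Suc n)}. (V t \<omega>)\<^sup>2 \<le> 400 * (1 + enn2real (H n \<omega>))))"
proof (rule square_summable_exhaustion[OF c])
  fix A :: "nat \<Rightarrow> 'i set"
  assume A0: "A 0 = {}" and Afin: "\<And>j. finite (A j)"
    and Amono: "\<And>j k. j \<le> k \<Longrightarrow> A j \<subseteq> A k"
    and tail: "\<And>j D. finite D \<Longrightarrow> D \<inter> A j = {} \<Longrightarrow> (\<Sum>z\<in>D. (c z)\<^sup>2) \<le> (B + 1) / 8 ^ j"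
  \<comment> \<open>Blocks of the series have variance at most \<open>t (B + 1) / 8\<^sup>j\<close>, so that the weights \<open>16\<^sup>j\<close> in \<open>H\<close>
    leave a convergent geometric series of ratio \<open>16 / 8\<^sup>2 = 1/4\<close>.\<close>
  define X where "X j t \<omega> = (\<Sum>z\<in>A (Suc j) - A j. c z * w t z \<omega>)" for j t \<omega>
  define V where "V t \<omega> = (\<Sum>j. X j t \<omega>)" for t \<omega>
  define H where "H n \<omega> = (\<Sum>j. ennreal (16 ^ j) * dyadic_functional (real (Suc n)) (\<lambda>t. X j t \<omega>))" for n \<omega>
  have X_meas: "X j t \<in> borel_measurable M" if "0 \<le> t" for j t
    unfolding X_def by (intro borel_measurable_sum borel_measurable_times borel_measurable_const brownian_measurable that)
  have D_meas[measurable]: "(\<lambda>\<omega>. dyadic_functional (real (Suc n)) (\<lambda>t. X j t \<omega>)) \<in> borel_measurable M" for n j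
    by (intro dyadic_functional_measurable X_meas) auto
  have H_meas[measurable]: "H n \<in> borel_measurable M" for n
    unfolding H_def by measurable
  have X_partial: "(\<Sum>i<j. X i t \<omega>) = (\<Sum>z\<in>A j. c z * w t z \<omega>)" for j t \<omega>
  proof (induction j)
    case (Suc j)
    have "(\<Sum>z\<in>A (Suc j). c z * w t z \<omega>) = X j t \<omega> + (\<Sum>z\<in>A j. c z * w t z \<omega>)"
      unfolding X_def using Amono[of j "Suc j"] Afin by (intro sum.subset_diff) auto
    then show ?case using Suc by simp
  qed (simp add: A0)
  have E_block: "(\<integral>\<^sup>+\<omega>. dyadic_functional (real (Suc n)) (\<lambda>t. X j t \<omega>) \<partial>M) \<le> ennreal (13 * (real (Suc n))\<^sup>2 * ((B + 1) / 8 ^ j)\<^sup>2)" for n j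
  proof -
    define v where "v = (\<Sum>z\<in>A (Suc j) - A j. (c z)\<^sup>2)"
    have v: "0 \<le> v" "v \<le> (B + 1) / 8 ^ j"
      unfolding v_def using Afin by (auto intro!: sum_nonneg tail)
    have "(\<integral>\<^sup>+\<omega>. dyadic_functional (real (Suc n)) (\<lambda>t. X j t \<omega>) \<partial>M) \<le> ennreal (13 * (real (Suc n))\<^sup>2 * v\<^sup>2)"
    proof (rule dyadic_functional_expectation[OF X_meas _ _ v(1)])
      fix s t :: real assume "0 \<le> s" "s \<le> t"
      then show "centered_gaussian M (\<lambda>\<omega>. X j t \<omega> - X j s \<omega>) ((t - s) * v)"
        using brownian_sum_increment[of s t "A (Suc j) - A j" c] Afin
        by (simp add: X_def v_def sum_subtractf right_diff_distrib)
    qed auto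
    also have "\<dots> \<le> ennreal (13 * (real (Suc n))\<^sup>2 * ((B + 1) / 8 ^ j)\<^sup>2)"
      using v by (intro ennreal_leI mult_left_mono power_mono) auto
    finally show ?thesis .
  qed
  have E_H: "(\<integral>\<^sup>+\<omega>. H n \<omega> \<partial>M) \<le> ennreal (18 * (real (Suc n))\<^sup>2 * (B + 1)\<^sup>2)" for n
  proof -
    have "(\<integral>\<^sup>+\<omega>. H n \<omega> \<partial>M) = (\<Sum>j. ennreal (16 ^ j) * (\<integral>\<^sup>+\<omega>. dyadic_functional (real (Suc n)) (\<lambda>t. X j t \<omega>) \<partial>M))"
      unfolding H_def by (subst nn_integral_suminf) (auto simp: nn_integral_cmult simp del: of_nat_Suc)
    also have "\<dots> \<le> (\<Sum>j. ennreal (16 ^ j) * ennreal (13 * (real (Suc n))\<^sup>2 * ((B + 1) / 8 ^ j)\<^sup>2))"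
      by (intro suminf_le mult_left_mono E_block) auto
    also have "\<dots> = (\<Sum>j. ennreal (13 * (real (Suc n))\<^sup>2 * (B + 1)\<^sup>2 * (1 / 4) ^ j))"
    proof (intro suminf_cong)
      fix j
      have "16 ^ j * (13 * (real (Suc n))\<^sup>2 * ((B + 1) / 8 ^ j)\<^sup>2) = 13 * (real (Suc n))\<^sup>2 * (B + 1)\<^sup>2 * (16 ^ j / (8 ^ j)\<^sup>2)"
        by (simp add: power_divide)
      also have "16 ^ j / (8 ^ j)\<^sup>2 = (1 / 4 :: real) ^ j"
        by (simp add: power2_eq_square power_mult_distrib[symmetric] power_divide[symmetric])
      finally show "ennreal (16 ^ j) * ennreal (13 * (real (Suc n))\<^sup>2 * ((B + 1) / 8 ^ j)\<^sup>2) = ennreal (13 * (real (Suc n))\<^sup>2 * (B + 1)\<^sup>2 * (1 / 4) ^ j)"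
        by (simp add: ennreal_mult[symmetric])
    qed
    also have "\<dots> = ennreal (\<Sum>j. 13 * (real (Suc n))\<^sup>2 * (B + 1)\<^sup>2 * (1 / 4) ^ j)"
      by (rule suminf_ennreal2) (auto intro!: summable_mult summable_geometric)
    also have "(\<Sum>j. 13 * (real (Suc n))\<^sup>2 * (B + 1)\<^sup>2 * (1 / 4) ^ j) = 13 * (real (Suc n))\<^sup>2 * (B + 1)\<^sup>2 * (4 / 3)"
      by (subst suminf_mult) (auto intro!: summable_geometric simp: suminf_geometric)
    also have "ennreal \<dots> \<le> ennreal (18 * (real (Suc n))\<^sup>2 * (B + 1)\<^sup>2)"
      by (intro ennreal_leI) simp
    finally show ?thesis .
  qed
  have "AE \<omega> in M. \<forall>n. H n \<omega> < \<infinity>"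
    unfolding AE_all_countable
  proof
    fix n
    have "(\<integral>\<^sup>+\<omega>. H n \<omega> \<partial>M) \<noteq> \<infinity>" using E_H[of n] by (auto simp: top_unique)
    then show "AE \<omega> in M. H n \<omega> < \<infinity>"
      using nn_integral_noteq_infinite[of "H n" M] by (simp add: less_top)
  qed
  then have paths: "AE \<omega> in M. (\<forall>n. continuous_on {0..real (Suc n)} (\<lambda>t. V t \<omega>) \<and>
      (\<forall>t\<in>{0..real (Suc n)}. summable (\<lambda>j. X j t \<omega>) \<and> (V t \<omega>)\<^sup>2 \<le> 400 * (1 + enn2real (H n \<omega>))))"
    using brownian_paths
  proof eventually_elim
    fix \<omega> assume fin: "\<forall>n. H n \<omega> < \<infinity>" and p: "\<forall>z. w 0 z \<omega> = 0 \<and> continuous_on {0..} (\<lambda>t. w t z \<omega>)"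
    have cont: "continuous_on {0..real (Suc n)} (\<lambda>t. X j t \<omega>)" for j n
    proof -
      have "continuous_on {0..real (Suc n)} (\<lambda>t. w t z \<omega>)" for z
        by (rule continuous_on_subset[of "{0..}"]) (use p in auto)
      then show ?thesis
        unfolding X_def by (intro continuous_on_sum continuous_on_mult continuous_on_const)
    qed
    have zero: "X j 0 \<omega> = 0" for j using p by (simp add: X_def)
    have "(\<Sum>j. ennreal (16 ^ j) * dyadic_functional (real (Suc n)) (\<lambda>t. X j t \<omega>)) < \<infinity>" for n
      using fin by (simp add: H_def)
    note b = block_series[OF cont zero _ this]
    show "\<forall>n. continuous_on {0..real (Suc n)} (\<lambda>t. V t \<omega>) \<and>
      (\<forall>t\<in>{0..real (Suc n)}. summable (\<lambda>j. X j t \<omega>) \<and> (V t \<omega>)\<^sup>2 \<le> 400 * (1 + enn2real (H n \<omega>)))"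
      unfolding V_def H_def by (intro allI conjI ballI b) auto
  qed
  have V_cont: "continuous_on {0..} f" if f: "\<forall>n. continuous_on {0..real (Suc n)} f" for f :: "real \<Rightarrow> real"
    unfolding continuous_on_def
  proof
    fix s :: real assume s: "s \<in> {0..}"
    obtain n where n: "s < real n" using reals_Archimedean2 by blast
    have "at s within {0..} = at s within {0..real (Suc n)}"
      by (rule at_within_nhd[of _ "{..<real n}"]) (use n s in auto)
    then show "(f \<longlongrightarrow> f s) (at s within {0..})"
      using f n s by (auto simp: continuous_on_def)
  qed
  have V_sum: "mean_square_has_sum M (\<lambda>z \<omega>. c z * w t z \<omega>) (V t)" if t: "0 \<le> t" for t
    unfolding mean_square_has_sum_def
  proof
    note [measurable] = X_meas[OF t] brownian_measurable[OF t]
    show V_meas[measurable]: "V t \<in> borel_measurable M"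
      unfolding V_def by measurable
    obtain n where n: "t < real n" using reals_Archimedean2 by blast
    have lim: "AE \<omega> in M. (\<lambda>j. \<Sum>z\<in>A j. c z * w t z \<omega>) \<longlonglongrightarrow> V t \<omega>"
      using paths
    proof eventually_elim
      case (elim \<omega>)
      then have "summable (\<lambda>j. X j t \<omega>)" using n t by (auto dest: spec[of _ n])
      then show ?case unfolding X_partial[symmetric] V_def by (rule summable_LIMSEQ)
    qed
    have dist: "(\<integral>\<^sup>+\<omega>. ennreal ((V t \<omega> - (\<Sum>z\<in>F. c z * w t z \<omega>))\<^sup>2) \<partial>M) \<le> ennreal (t * ((B + 1) / 8 ^ N))"
      if F: "finite F" "A N \<subseteq> F" for F N
    proof -
      \<comment> \<open>Fatou's lemma along the partial sums over \<open>A j\<close>, which converge almost surely.\<close>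
      have "(\<integral>\<^sup>+\<omega>. ennreal ((V t \<omega> - (\<Sum>z\<in>F. c z * w t z \<omega>))\<^sup>2) \<partial>M) =
        (\<integral>\<^sup>+\<omega>. liminf (\<lambda>j. ennreal (((\<Sum>z\<in>A j. c z * w t z \<omega>) - (\<Sum>z\<in>F. c z * w t z \<omega>))\<^sup>2)) \<partial>M)"
      proof (rule nn_integral_cong_AE)
        show "AE \<omega> in M. ennreal ((V t \<omega> - (\<Sum>z\<in>F. c z * w t z \<omega>))\<^sup>2) =
          liminf (\<lambda>j. ennreal (((\<Sum>z\<in>A j. c z * w t z \<omega>) - (\<Sum>z\<in>F. c z * w t z \<omega>))\<^sup>2))"
          using lim
        proof eventually_elim
          case (elim \<omega>)
          have "(\<lambda>j. ennreal (((\<Sum>z\<in>A j. c z * w t z \<omega>) - (\<Sum>z\<in>F. c z * w t z \<omega>))\<^sup>2)) \<longlonglongrightarrow>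
              ennreal ((V t \<omega> - (\<Sum>z\<in>F. c z * w t z \<omega>))\<^sup>2)"
            by (intro tendsto_ennrealI tendsto_intros elim)
          from lim_imp_Liminf[OF sequentially_bot this] show ?case by (rule sym)
        qed
      qed
      also have "\<dots> \<le> liminf (\<lambda>j. \<integral>\<^sup>+\<omega>. ennreal (((\<Sum>z\<in>A j. c z * w t z \<omega>) - (\<Sum>z\<in>F. c z * w t z \<omega>))\<^sup>2) \<partial>M)"
        by (rule nn_integral_liminf) measurable
      also have "\<dots> \<le> limsup (\<lambda>j. \<integral>\<^sup>+\<omega>. ennreal (((\<Sum>z\<in>A j. c z * w t z \<omega>) - (\<Sum>z\<in>F. c z * w t z \<omega>))\<^sup>2) \<partial>M)"
        by (rule Liminf_le_Limsup) simp
      also have "\<dots> \<le> ennreal (t * ((B + 1) / 8 ^ N))"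
      proof (rule Limsup_bounded)
        show "\<forall>\<^sub>F j in sequentially. (\<integral>\<^sup>+\<omega>. ennreal (((\<Sum>z\<in>A j. c z * w t z \<omega>) - (\<Sum>z\<in>F. c z * w t z \<omega>))\<^sup>2) \<partial>M)
            \<le> ennreal (t * ((B + 1) / 8 ^ N))"
          using eventually_ge_at_top[of N]
          by eventually_elim (intro brownian_partial_sums_distance[where N="A N"] t Afin F Amono tail)
      qed
      finally show ?thesis .
    qed
    have "(\<lambda>N. t * ((B + 1) * (1 / 8) ^ N)) \<longlonglongrightarrow> t * ((B + 1) * 0)"
      by (intro tendsto_intros LIMSEQ_realpow_zero) auto
    then have "(\<lambda>N. ennreal (t * ((B + 1) / 8 ^ N))) \<longlonglongrightarrow> 0"
      using tendsto_ennrealI[of _ "0::real"] by (auto simp: power_one_over field_simps)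
    note small = order_tendstoD(2)[OF this]
    show "((\<lambda>F. \<integral>\<^sup>+\<omega>. ennreal ((V t \<omega> - (\<Sum>z\<in>F. c z * w t z \<omega>))\<^sup>2) \<partial>M) \<longlongrightarrow> 0) (finite_subsets_at_top UNIV)"
    proof (rule order_tendstoI)
      fix a :: ennreal assume "0 < a"
      then obtain N where N: "ennreal (t * ((B + 1) / 8 ^ N)) < a"
        using small[of a] by (auto simp: eventually_sequentially)
      show "\<forall>\<^sub>F F in finite_subsets_at_top UNIV. (\<integral>\<^sup>+\<omega>. ennreal ((V t \<omega> - (\<Sum>z\<in>F. c z * w t z \<omega>))\<^sup>2) \<partial>M) < a"
        unfolding eventually_finite_subsets_at_top
        using Afin[of N] dist N by (intro exI[of _ "A N"]) (auto intro: le_less_trans)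
    qed simp
  qed
  show ?thesis
  proof (intro exI[of _ V] exI[of _ H] conjI allI impI V_sum H_meas E_H)
    show "AE \<omega> in M. continuous_on {0..} (\<lambda>t. V t \<omega>) \<and>
       (\<forall>n. \<forall>t\<in>{0..real (Suc n)}. (V t \<omega>)\<^sup>2 \<le> 400 * (1 + enn2real (H n \<omega>)))"
      using paths by eventually_elim (use V_cont in auto)
  qed
qed

end

section \<open>Paths in the weighted sequence space\<close>

lemma AE_summable_of_expectation_bound:
  fixes H :: "'x::countable \<Rightarrow> 'a \<Rightarrow> ennreal"
  assumes [measurable]: "\<And>x. H x \<in> borel_measurable M" and C: "\<And>x. (\<integral>\<^sup>+\<omega>. H x \<omega> \<partial>M) \<le> ennreal C"
    and \<mu>: "\<And>x. \<mu> x \<ge> 0" "\<mu> summable_on UNIV"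
  shows "AE \<omega> in M. (\<lambda>x. \<mu> x * enn2real (H x \<omega>)) summable_on UNIV"
proof -
  have int: "integrable (count_space UNIV) \<mu>"
    using \<mu>(2) summable_on_iff_abs_summable_on_real abs_summable_equivalent abs_summable_on_def by metis
  have meas[measurable]: "(\<lambda>\<omega>. \<integral>\<^sup>+x. ennreal (\<mu> x) * H x \<omega> \<partial>count_space UNIV) \<in> borel_measurable M"
  proof (rule sigma_finite_measure.borel_measurable_nn_integral[OF sigma_finite_measure_count_space])
    have "(\<lambda>(x, \<omega>). ennreal (\<mu> x) * H x \<omega>) \<in> borel_measurable (count_space UNIV \<Otimes>\<^sub>M M)"
      by (rule measurable_pair_measure_countable1) auto
    from measurable_pair_swap[OF this]
    show "(\<lambda>(\<omega>, x). ennreal (\<mu> x) * H x \<omega>) \<in> borel_measurable (M \<Otimes>\<^sub>M count_space UNIV)"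
      by simp
  qed
  have "(\<integral>\<^sup>+\<omega>. (\<integral>\<^sup>+x. ennreal (\<mu> x) * H x \<omega> \<partial>count_space UNIV) \<partial>M)
      = (\<integral>\<^sup>+x. (\<integral>\<^sup>+\<omega>. ennreal (\<mu> x) * H x \<omega> \<partial>M) \<partial>count_space UNIV)"
    by (rule nn_integral_count_space_nn_integral) auto
  also have "\<dots> = (\<integral>\<^sup>+x. ennreal (\<mu> x) * (\<integral>\<^sup>+\<omega>. H x \<omega> \<partial>M) \<partial>count_space UNIV)"
    by (simp add: nn_integral_cmult)
  also have "\<dots> \<le> (\<integral>\<^sup>+x. ennreal (\<mu> x) * ennreal C \<partial>count_space UNIV)"
    by (intro nn_integral_mono mult_left_mono C) auto
  also have "\<dots> = (\<integral>\<^sup>+x. ennreal (\<mu> x) \<partial>count_space UNIV) * ennreal C"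
    by (rule nn_integral_multc) auto
  also have "\<dots> < \<infinity>"
    using int \<mu>(1) by (simp add: nn_integral_eq_integral ennreal_mult_less_top)
  finally have "AE \<omega> in M. (\<integral>\<^sup>+x. ennreal (\<mu> x) * H x \<omega> \<partial>count_space UNIV) \<noteq> \<infinity>"
    by (intro nn_integral_noteq_infinite meas) auto
  then show ?thesis
  proof eventually_elim
    case (elim \<omega>)
    have "(\<integral>\<^sup>+x. ennreal (norm (\<mu> x * enn2real (H x \<omega>))) \<partial>count_space UNIV)
        \<le> (\<integral>\<^sup>+x. ennreal (\<mu> x) * H x \<omega> \<partial>count_space UNIV)"
      using \<mu>(1) by (intro nn_integral_mono) (auto simp: ennreal_mult ennreal_enn2real_if abs_mult intro: mult_left_mono)
    also have "\<dots> < \<infinity>" using elim by (simp add: less_top)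
    finally have "integrable (count_space UNIV) (\<lambda>x. \<mu> x * enn2real (H x \<omega>))"
      by (intro integrableI_bounded) auto
    then show ?case
      using summable_on_iff_abs_summable_on_real abs_summable_equivalent abs_summable_on_def by metis
  qed
qed

text \<open>
  Continuity in each coordinate with a domination that is uniform on bounded time intervals gives
  continuity in norm, by the Weierstrass test for \<open>\<Sum>\<^sub>x \<bar>u t x - u s x\<bar>\<^sup>2 \<mu> x\<close>.
\<close>

lemma weighted_l2_continuousI:
  fixes u :: "real \<Rightarrow> 'x \<Rightarrow> real"
  assumes cont: "\<And>x. continuous_on {0..} (\<lambda>t. u t x)"
    and bound: "\<And>n x t. 0 \<le> t \<Longrightarrow> t \<le> real (Suc n) \<Longrightarrow> (u t x)\<^sup>2 * \<mu> x \<le> g n x"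
    and g: "\<And>n. g n summable_on UNIV" and \<mu>: "\<And>x. \<mu> x \<ge> 0"
  shows "weighted_l2_continuous \<mu> u"
  unfolding weighted_l2_continuous_def
proof (intro conjI allI impI)
  fix t :: real assume t: "t \<ge> 0"
  obtain n where "t < real n" using reals_Archimedean2 by blast
  then have "(u t x)\<^sup>2 * \<mu> x \<le> g n x" for x using t by (intro bound) auto
  then show "u t \<in> weighted_l2 \<mu>"
    unfolding weighted_l2_def using \<mu> by (auto intro!: summable_on_comparison_test[OF g[of n]])
next
  fix s :: real assume s: "s \<ge> 0"
  obtain n where n: "s < real n" using reals_Archimedean2 by blast
  let ?Y = "{0..real (Suc n)}"
  let ?f = "\<lambda>x t. \<bar>u t x - u s x\<bar>\<^sup>2 * \<mu> x"
  have "uniform_limit ?Y (\<lambda>X t. \<Sum>x\<in>X. ?f x t) (\<lambda>t. \<Sum>\<^sub>\<infinity>x. ?f x t) (finite_subsets_at_top UNIV)"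
  proof (rule Weierstrass_m_test_general)
    show "(\<lambda>x. 4 * g n x) summable_on UNIV" by (intro summable_on_cmult_right g)
    fix x t assume t: "t \<in> ?Y"
    have "(u t x - u s x)\<^sup>2 \<le> 2 * (u t x)\<^sup>2 + 2 * (u s x)\<^sup>2"
      using zero_le_power2[of "u t x + u s x"] by (simp add: power2_eq_square algebra_simps)
    then have "(u t x - u s x)\<^sup>2 * \<mu> x \<le> (2 * (u t x)\<^sup>2 + 2 * (u s x)\<^sup>2) * \<mu> x"
      using \<mu> by (rule mult_right_mono)
    also have "\<dots> = 2 * ((u t x)\<^sup>2 * \<mu> x) + 2 * ((u s x)\<^sup>2 * \<mu> x)" by (simp add: algebra_simps)
    also have "\<dots> \<le> 2 * g n x + 2 * g n x"
      using t s n by (intro add_mono mult_left_mono bound) auto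
    finally show "norm (?f x t) \<le> 4 * g n x" using \<mu> by simp
  qed
  then have "continuous_on ?Y (\<lambda>t. \<Sum>\<^sub>\<infinity>x. ?f x t)"
  proof (rule uniform_limit_theorem[rotated])
    have "continuous_on ?Y (\<lambda>t. u t x)" for x
      by (rule continuous_on_subset[OF cont]) auto
    then show "\<forall>\<^sub>F X in finite_subsets_at_top UNIV. continuous_on ?Y (\<lambda>t. \<Sum>x\<in>X. ?f x t)"
      by (intro always_eventually allI continuous_intros)
  qed simp
  then have "((\<lambda>t. sqrt (\<Sum>\<^sub>\<infinity>x. ?f x t)) \<longlongrightarrow> sqrt (\<Sum>\<^sub>\<infinity>x. ?f x s)) (at s within ?Y)"
    by (intro tendsto_real_sqrt continuous_on_def[THEN iffD1, rule_format]) (use s n in auto)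
  moreover have "at s within {0..} = at s within ?Y"
    by (rule at_within_nhd[of _ "{..<real n}"]) (use n s in auto)
  ultimately show "((\<lambda>t. weighted_l2_norm \<mu> (\<lambda>x. u t x - u s x)) \<longlongrightarrow> 0) (at s within {0..})"
    by (simp add: weighted_l2_norm_def)
qed

theorem theorem3p1:
  fixes M :: "'a measure"
    and w :: "real \<Rightarrow> int ^ 'd \<Rightarrow> 'a \<Rightarrow> real"
    and b :: "int ^ 'd \<Rightarrow> real"
    and \<mu> :: "int ^ 'd \<Rightarrow> real"
    and B0 :: real
  assumes "prob_space M"
    and "independent_brownian_motions M w"
    and "((\<lambda>x. (b x)\<^sup>2) has_sum B0) UNIV"
    and "\<And>x. \<mu> x > 0"
    and "\<mu> summable_on UNIV"
  shows "(\<exists>W. is_lattice_field M b w W) \<and>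
    (\<forall>W. is_lattice_field M b w W \<longrightarrow>
       gaussian_field M ({0..} \<times> UNIV) (\<lambda>(t, x). W t x) \<and>
       (\<exists>V. is_modification M V W \<and>
            (AE \<omega> in M. weighted_l2_continuous \<mu> (\<lambda>t x. V t x \<omega>))))"
proof -
  interpret prob_space M by fact
  interpret brownian_family M w by unfold_locales fact
  have \<mu>: "\<mu> x \<ge> 0" for x using assms(4)[of x] by simp
  let ?C = "\<lambda>n. 18 * (real (Suc n))\<^sup>2 * (B0 + 1)\<^sup>2"
  have "((\<lambda>z. (b (x - z))\<^sup>2) has_sum B0) UNIV" for x
  proof -
    have "bij (\<lambda>z. x - z)" by (rule bij_betw_byWitness[where f'="\<lambda>z. x - z"]) auto
    from has_sum_reindex_bij_betw[OF this, of "\<lambda>z. (b z)\<^sup>2"] show ?thesis using assms(3) by simp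
  qed
  let ?P = "\<lambda>x V H. (\<forall>t\<ge>0. mean_square_has_sum M (\<lambda>z \<omega>. b (x - z) * w t z \<omega>) (V t)) \<and>
    (\<forall>n. H n \<in> borel_measurable M \<and> (\<integral>\<^sup>+\<omega>. H n \<omega> \<partial>M) \<le> ennreal (?C n)) \<and>
    (AE \<omega> in M. continuous_on {0..} (\<lambda>t. V t \<omega>) \<and>
       (\<forall>n. \<forall>t\<in>{0..real (Suc n)}. (V t \<omega>)\<^sup>2 \<le> 400 * (1 + enn2real (H n \<omega>))))"
  have series: "\<forall>x. \<exists>V H. ?P x V H"
    by (intro allI brownian_series_continuous) fact
  obtain V H where
    V: "\<And>x t. 0 \<le> t \<Longrightarrow> mean_square_has_sum M (\<lambda>z \<omega>. b (x - z) * w t z \<omega>) (V x t)" and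
    H: "\<And>x n. H x n \<in> borel_measurable M" "\<And>x n. (\<integral>\<^sup>+\<omega>. H x n \<omega> \<partial>M) \<le> ennreal (?C n)" and
    paths: "\<And>x. AE \<omega> in M. continuous_on {0..} (\<lambda>t. V x t \<omega>) \<and>
       (\<forall>n. \<forall>t\<in>{0..real (Suc n)}. (V x t \<omega>)\<^sup>2 \<le> 400 * (1 + enn2real (H x n \<omega>)))"
  proof -
    from choice[OF series] obtain V where "\<forall>x. \<exists>H. ?P x (V x) H" by blast
    from choice[OF this] obtain H where "\<forall>x. ?P x (V x) (H x)" by blast
    then show ?thesis using that[of V H] by blast
  qed
  have field: "is_lattice_field M b w (\<lambda>t x. V x t)"
    using V by (simp add: is_lattice_field_def)
  have "AE \<omega> in M. \<forall>n. (\<lambda>x. \<mu> x * enn2real (H x n \<omega>)) summable_on UNIV"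
    unfolding AE_all_countable
    by (intro allI AE_summable_of_expectation_bound[OF H] \<mu> assms(5))
  moreover have "AE \<omega> in M. \<forall>x. continuous_on {0..} (\<lambda>t. V x t \<omega>) \<and>
       (\<forall>n. \<forall>t\<in>{0..real (Suc n)}. (V x t \<omega>)\<^sup>2 \<le> 400 * (1 + enn2real (H x n \<omega>)))"
    unfolding AE_all_countable using paths by blast
  ultimately have l2: "AE \<omega> in M. weighted_l2_continuous \<mu> (\<lambda>t x. V x t \<omega>)"
  proof eventually_elim
    case (elim \<omega>)
    show ?case
    proof (rule weighted_l2_continuousI[OF _ _ _ \<mu>])
      show "(\<lambda>x. 400 * (\<mu> x + \<mu> x * enn2real (H x n \<omega>))) summable_on UNIV" for n
        using elim assms(5) by (intro summable_on_cmult_right summable_on_add) auto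
      fix n x t assume "0 \<le> t" "t \<le> real (Suc n)"
      then have "(V x t \<omega>)\<^sup>2 \<le> 400 * (1 + enn2real (H x n \<omega>))" using elim by simp
      then have "(V x t \<omega>)\<^sup>2 * \<mu> x \<le> 400 * (1 + enn2real (H x n \<omega>)) * \<mu> x"
        using \<mu> by (rule mult_right_mono)
      then show "(V x t \<omega>)\<^sup>2 * \<mu> x \<le> 400 * (\<mu> x + \<mu> x * enn2real (H x n \<omega>))"
        by (simp add: algebra_simps)
    qed (use elim in blast)
  qed
  show ?thesis
  proof (intro conjI allI impI)
    show "\<exists>W. is_lattice_field M b w W" using field by blast
    fix W assume W: "is_lattice_field M b w W"
    show "gaussian_field M ({0..} \<times> UNIV) (\<lambda>(t, x). W t x)"
      by (rule gaussian_field_of_mean_square_sums[of "\<lambda>x z. b (x - z)"])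
        (use W in \<open>simp add: is_lattice_field_def\<close>)
    have "is_modification M (\<lambda>t x. V x t) W"
      unfolding is_modification_def AE_all_countable
    proof (intro allI impI conjI)
      fix t :: real and x assume t: "0 \<le> t"
      show "V x t \<in> borel_measurable M" using V[OF t] by (simp add: mean_square_has_sum_def)
      show "AE \<omega> in M. V x t \<omega> = W t x \<omega>"
        using W t brownian_measurable[OF t]
        by (intro mean_square_has_sum_unique[OF _ V[OF t]]) (auto simp: is_lattice_field_def)
    qed
    then show "\<exists>V. is_modification M V W \<and> (AE \<omega> in M. weighted_l2_continuous \<mu> (\<lambda>t x. V t x \<omega>))"
      using l2 by blast
  qed
qed

end
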